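(* Let $m\ge2$ be an integer and let $X_0^*$ be a random variable with values in $\{1,2,\dots\}$ such that $\mathbf P(X_0^*=k)\sim c_0\, m^{-k}k^{-2}$ as $k\to\infty$, for some constant $0<c_0<\infty$. Then $p_c(X_0^* )=0$ and $$F_\infty(p)=\exp\Big(-\mathrm e^{(C+o(1))/p}\Big),\qquad p\downarrow 0,$$ where $C:=\frac{1}{(m-1)c_0}$.
   Context: Recursive system: fix an integer $m\ge2$. For a $\mathbb Z_+$-valued random variable $X_0$, define recursively the laws of $X_n$, $n\ge0$, by requiring that $X_{n+1}$ has the law of $(X_{n,1}+\cdots+X_{n,m}-1)^+$, where $X_{n,1},\dots,X_{n,m}$ are independent copies of $X_n$. The free energy is $F_\infty:=\lim_{n\to\infty}\mathbf E(X_n)/m^n$. Parametrized family: given $X_0^*$ and $p\in[0,1]$, let $X_0$ have law $(1-p)\delta_0+p\,P_{X_0^*}$, and let $F_\infty(p)$ denote the free energy of the resulting system. $p_c(X_0^* )$ is the threshold such that $F_\infty(p)>0$ for $p>p_c$ and $F_\infty(p)=0$ for $p<p_c$; it equals $\frac{1}{1+\mathbf E\{[(m-1)X_0^*-1]m^{X_0^*}\}}$, interpreted as $0$ when this expectation is infinite. *)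

theory Defs
  imports "HOL-Probability.Probability" "HOL-Library.Landau_Symbols"
begin

fun sum_iid :: "nat \<Rightarrow> nat pmf \<Rightarrow> nat pmf" where
  "sum_iid 0 mu = return_pmf 0"
| "sum_iid (Suc k) mu = bind_pmf mu (\<lambda>x. map_pmf (\<lambda>s. x + s) (sum_iid k mu))"

text \<open>One step of the recursive system: law of (X_1+...+X_m - 1)^+ (truncated nat subtraction).\<close>
definition rs_step :: "nat \<Rightarrow> nat pmf \<Rightarrow> nat pmf" where
  "rs_step m mu = map_pmf (\<lambda>s. s - 1) (sum_iid m mu)"

definition rs_law :: "nat \<Rightarrow> nat pmf \<Rightarrow> nat \<Rightarrow> nat pmf" where
  "rs_law m mu0 n = (rs_step m ^^ n) mu0"

definition pmf_mean :: "nat pmf \<Rightarrow> ennreal" where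
  "pmf_mean mu = (\<integral>\<^sup>+ x. ennreal (real x) \<partial>measure_pmf mu)"

definition free_energy :: "nat \<Rightarrow> nat pmf \<Rightarrow> real" where
  "free_energy m mu0 = lim (\<lambda>n. enn2real (pmf_mean (rs_law m mu0 n)) / real m ^ n)"

definition mix_law :: "real \<Rightarrow> nat pmf \<Rightarrow> nat pmf" where
  "mix_law p X = bind_pmf (bernoulli_pmf p) (\<lambda>b. if b then X else return_pmf 0)"

definition free_energy_p :: "nat \<Rightarrow> nat pmf \<Rightarrow> real \<Rightarrow> real" where
  "free_energy_p m X p = free_energy m (mix_law p X)"

definition p_crit :: "nat \<Rightarrow> nat pmf \<Rightarrow> real" where
  "p_crit m X = Inf {p \<in> {0..1}. 0 < free_energy_p m X p}"

end

theory Submission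
  imports Defs "HOL-Real_Asymp.Real_Asymp"
begin

text \<open>
  For \<open>s > 0\<close> let \<open>drift s\<close> be \<open>(s - 1) E[X s\<^sup>X] - E[s\<^sup>X]\<close>. One step of the recursion multiplies
  \<open>drift m\<close> by \<open>E[m\<^sup>X]\<^bsup>m-1\<^esup>\<close>, so its sign is preserved, and \<open>drift m \<le> 0\<close> keeps the mean bounded.
  Under the mixed law truncated at \<open>L\<close>, \<open>drift m\<close> is about \<open>(m - 1) c\<^sub>0 p ln L - 1\<close>, which changes
  sign at \<open>L = exp (C / p)\<close>.

  Upper bound: for \<open>L = exp ((C - \<epsilon>) / p)\<close> the truncated system has bounded means, and the
  truncation changes the free energy by at most \<open>E[X\<^sub>0; X\<^sub>0 > L]\<close>, which is of order \<open>m\<^bsup>-L\<^esup>\<close>.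

  Lower bound: let \<open>K = exp ((C + \<epsilon>) / p)\<close> and \<open>s = m (1 - \<eta>)\<close> with \<open>\<eta> = (ln K)\<^sup>2 / K\<close>. If the means
  stayed below \<open>2\<close> up to time \<open>2K\<close>, then all tails would satisfy \<open>P(X\<^sub>n \<ge> k) \<le> m\<^bsup>4-k\<^esup>\<close>, so that truncating
  at \<open>K\<close> in every step would cost less than \<open>\<eta>\<close>, and \<open>drift s\<close> would grow by a factor \<open>1 + \<eta>\<close> per step.
  After \<open>K\<close> steps this exceeds the polynomial bound on \<open>drift s\<close> that the tails give. Hence some mean exceeds
  \<open>2\<close> before time \<open>2K\<close>, and the free energy is at least \<open>m\<^bsup>-2K\<^esup>\<close>.
\<close>

section \<open>Means and the free energy\<close>

lemma pmf_sum_iid_0: "pmf (sum_iid k mu) 0 = pmf mu 0 ^ k"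
proof (induction k)
  case (Suc k)
  have *: "pmf (map_pmf ((+) x) (sum_iid k mu)) 0 = indicator {0} x * pmf (sum_iid k mu) 0" for x
    by (cases x) (auto simp: pmf_eq_0_set_pmf pmf.map_ident_strong)
  have "pmf (sum_iid (Suc k) mu) 0 = (\<integral>x. indicator {0} x * pmf (sum_iid k mu) 0 \<partial>measure_pmf mu)"
    by (simp add: pmf_bind *)
  also have "\<dots> = pmf mu 0 * pmf (sum_iid k mu) 0"
    by (simp add: measure_pmf_single)
  finally show ?case
    by (simp add: Suc)
qed simp

lemma pmf_mean_sum_iid: "pmf_mean (sum_iid k mu) = of_nat k * pmf_mean mu"
proof (induction k)
  case (Suc k)
  have "pmf_mean (sum_iid (Suc k) mu)
      = (\<integral>\<^sup>+x. (\<integral>\<^sup>+y. ennreal (real x) + ennreal (real y) \<partial>sum_iid k mu) \<partial>mu)"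
    by (simp add: pmf_mean_def)
  also have "\<dots> = (\<integral>\<^sup>+x. ennreal (real x) + pmf_mean (sum_iid k mu) \<partial>mu)"
    by (subst nn_integral_add) (auto simp: pmf_mean_def)
  also have "\<dots> = pmf_mean mu + pmf_mean (sum_iid k mu)"
    by (subst nn_integral_add) (auto simp: pmf_mean_def)
  finally show ?case
    by (simp add: Suc algebra_simps)
qed (simp add: pmf_mean_def)

text \<open>The pointwise identity (x - 1)^+ + 1 = x + 1_{x = 0} is integrated against the law of
  the sum, which is 0 exactly when all \<open>m\<close> copies are. The unit stays on the left
  because subtraction in \<open>ennreal\<close> truncates.\<close>

lemma pmf_mean_rs_step:
  "pmf_mean (rs_step m mu) + 1 = of_nat m * pmf_mean mu + ennreal (pmf mu 0 ^ m)"
proof -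
  have *: "ennreal (real (x - 1)) + 1 = ennreal (real x) + indicator {0} x" for x :: nat
    by (cases x) (auto simp flip: ennreal_plus ennreal_1)
  have "pmf_mean (rs_step m mu) + 1 = (\<integral>\<^sup>+x. ennreal (real (x - 1)) + 1 \<partial>sum_iid m mu)"
    by (subst nn_integral_add) (auto simp: pmf_mean_def rs_step_def)
  also have "\<dots> = (\<integral>\<^sup>+x. ennreal (real x) + indicator {0} x \<partial>sum_iid m mu)"
    by (simp only: *)
  also have "\<dots> = pmf_mean (sum_iid m mu) + ennreal (pmf (sum_iid m mu) 0)"
    by (subst nn_integral_add) (auto simp: pmf_mean_def emeasure_pmf_single)
  finally show ?thesis
    by (simp add: pmf_mean_sum_iid pmf_sum_iid_0)
qed

lemma rs_law_0 [simp]: "rs_law m mu 0 = mu"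
  and rs_law_Suc: "rs_law m mu (Suc n) = rs_step m (rs_law m mu n)"
  by (simp_all add: rs_law_def)

lemma pmf_mean_rs_step_finite: "pmf_mean mu < top \<Longrightarrow> pmf_mean (rs_step m mu) < top"
proof -
  assume "pmf_mean mu < top"
  then have "pmf_mean (rs_step m mu) + 1 < top"
    by (simp add: pmf_mean_rs_step ennreal_mult_less_top of_nat_less_top)
  then show ?thesis by simp
qed

lemma pmf_mean_rs_law_finite: "pmf_mean mu < top \<Longrightarrow> pmf_mean (rs_law m mu n) < top"
  by (induction n) (auto simp: rs_law_Suc pmf_mean_rs_step_finite)

lemma enn2real_pmf_mean_rs_step:
  assumes "pmf_mean mu < top"
  shows "enn2real (pmf_mean (rs_step m mu)) = real m * enn2real (pmf_mean mu) - 1 + pmf mu 0 ^ m"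
proof -
  obtain a where a: "a \<ge> 0" "pmf_mean mu = ennreal a"
    using assms by (cases "pmf_mean mu") auto
  obtain b where b: "b \<ge> 0" "pmf_mean (rs_step m mu) = ennreal b"
    using pmf_mean_rs_step_finite[OF assms, of m] by (cases "pmf_mean (rs_step m mu)") auto
  have "ennreal (b + 1) = ennreal (real m * a + pmf mu 0 ^ m)"
    using pmf_mean_rs_step[of m mu] a b
    by (simp add: ennreal_mult' ennreal_of_nat_eq_real_of_nat)
  then have "b + 1 = real m * a + pmf mu 0 ^ m"
    using a b by (subst (asm) ennreal_inj) auto
  then show ?thesis
    using a b by simp
qed

text \<open>A finite mean passes to every generation, so \<open>enn2real\<close> never turns an
  infinite mean into 0.\<close>

locale rs =
  fixes m :: nat and mu :: "nat pmf"
  assumes m_ge_2: "m \<ge> 2" and finite_mean: "pmf_mean mu < top"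
begin

definition mean :: "nat \<Rightarrow> real" where "mean n = enn2real (pmf_mean (rs_law m mu n))"

lemma mean_nonneg: "mean n \<ge> 0"
  by (simp add: mean_def)

lemma ennreal_mean: "ennreal (mean n) = pmf_mean (rs_law m mu n)"
  unfolding mean_def using pmf_mean_rs_law_finite[OF finite_mean] by (simp add: less_top)

lemma mean_Suc: "mean (Suc n) = real m * mean n - 1 + pmf (rs_law m mu n) 0 ^ m"
  unfolding mean_def rs_law_Suc
  by (rule enn2real_pmf_mean_rs_step[OF pmf_mean_rs_law_finite[OF finite_mean]])

lemma mean_scaled_Suc_le: "mean (Suc n) / real m ^ Suc n \<le> mean n / real m ^ n"
proof -
  have "pmf (rs_law m mu n) 0 ^ m \<le> 1"
    by (intro power_le_one) (auto simp: pmf_le_1)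
  then have "mean (Suc n) \<le> real m * mean n"
    by (simp add: mean_Suc)
  then have "mean (Suc n) / real m ^ Suc n \<le> (real m * mean n) / real m ^ Suc n"
    by (intro divide_right_mono) auto
  then show ?thesis using m_ge_2 by simp
qed

lemma free_energy_limit: "(\<lambda>n. mean n / real m ^ n) \<longlonglongrightarrow> free_energy m mu"
proof -
  have "decseq (\<lambda>n. mean n / real m ^ n)"
    using mean_scaled_Suc_le by (intro decseq_SucI)
  then have "convergent (\<lambda>n. mean n / real m ^ n)"
    by (rule decseq_convergent[where B = 0]) (auto simp: mean_nonneg convergentI)
  then show ?thesis
    by (simp add: convergent_LIMSEQ_iff free_energy_def mean_def)
qed

text \<open>While \<open>mean n / real m ^ n\<close> decreases in n, subtracting 1 in the numerator
  makes the quotient increase, because m >= 2. A single mean above 1 thus gives an explicit positive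
  lower bound for the limit.\<close>

lemma free_energy_lower: "(mean n - 1) / real m ^ n \<le> free_energy m mu"
proof (rule tendsto_lowerbound[OF free_energy_limit])
  have step: "(mean k - 1) / real m ^ k \<le> (mean (Suc k) - 1) / real m ^ Suc k" for k
  proof -
    have "real m * mean k - 1 \<le> mean (Suc k)"
      by (simp add: mean_Suc)
    then have "real m * (mean k - 1) \<le> mean (Suc k) - 1"
      using m_ge_2 by (simp add: algebra_simps)
    then have "real m * (mean k - 1) / real m ^ Suc k \<le> (mean (Suc k) - 1) / real m ^ Suc k"
      by (intro divide_right_mono) auto
    then show ?thesis using m_ge_2 by simp
  qed
  have "(mean n - 1) / real m ^ n \<le> mean k / real m ^ k" if "k \<ge> n" for k
  proof -
    have "(mean n - 1) / real m ^ n \<le> (mean k - 1) / real m ^ k"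
      using lift_Suc_mono_le[of "\<lambda>k. (mean k - 1) / real m ^ k", OF step that] .
    also have "\<dots> \<le> mean k / real m ^ k"
      by (intro divide_right_mono) auto
    finally show ?thesis .
  qed
  then show "\<forall>\<^sub>F k in sequentially. (mean n - 1) / real m ^ n \<le> mean k / real m ^ k"
    by (auto simp: eventually_sequentially)
qed simp

end

section \<open>Truncation and stochastic order\<close>

text \<open>Sending values above \<open>K\<close> to 0 keeps the masses at 1, ..., K and couples the
  law below \<open>mu\<close>. The finite support makes every real function integrable.\<close>

definition trunc_pmf :: "nat \<Rightarrow> nat pmf \<Rightarrow> nat pmf" where
  "trunc_pmf K mu = map_pmf (\<lambda>x. if x \<le> K then x else 0) mu"

lemma set_pmf_trunc_pmf: "set_pmf (trunc_pmf K mu) \<subseteq> {..K}"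
  by (auto simp: trunc_pmf_def)

lemma finite_set_pmf_trunc_pmf [simp]: "finite (set_pmf (trunc_pmf K mu))"
  by (rule finite_subset[OF set_pmf_trunc_pmf]) simp

text \<open>Stochastic domination is used in its coupling form \<open>rel_pmf (\<le>)\<close>; here
  both laws are read off the same sample.\<close>

lemma trunc_pmf_le: "rel_pmf (\<le>) (trunc_pmf K mu) mu"
  unfolding trunc_pmf_def by (simp add: pmf.rel_map rel_pmf_reflI)

lemma rel_pmf_le_trans: "rel_pmf (\<le>) mu nu \<Longrightarrow> rel_pmf (\<le>) nu rho \<Longrightarrow> rel_pmf (\<le>) mu (rho :: nat pmf)"
  using transp_rel_pmf[of "(\<le>) :: nat \<Rightarrow> nat \<Rightarrow> bool"] by (meson transpD transp_on_le)

lemma sum_iid_mono: "rel_pmf (\<le>) mu nu \<Longrightarrow> rel_pmf (\<le>) (sum_iid k mu) (sum_iid k nu)"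
proof (induction k)
  case (Suc k)
  show ?case
    using Suc.prems
  proof (simp, rule rel_pmf_bindI)
    fix x y :: nat assume "x \<le> y"
    then show "rel_pmf (\<le>) (map_pmf ((+) x) (sum_iid k mu)) (map_pmf ((+) y) (sum_iid k nu))"
      using Suc by (auto simp: pmf.rel_map intro: pmf.rel_mono_strong add_mono)
  qed
qed simp

lemma rs_step_mono: "rel_pmf (\<le>) mu nu \<Longrightarrow> rel_pmf (\<le>) (rs_step m mu) (rs_step m nu)"
  unfolding rs_step_def pmf.rel_map
  by (rule pmf.rel_mono_strong[OF sum_iid_mono]) auto

lemma rs_law_mono: "rel_pmf (\<le>) mu nu \<Longrightarrow> rel_pmf (\<le>) (rs_law m mu n) (rs_law m nu n)"
  by (induction n) (auto simp: rs_law_Suc rs_step_mono)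

lemma measure_pmf_mono_le:
  assumes "rel_pmf (\<le>) mu (nu :: nat pmf)"
  shows "measure_pmf.prob mu {k..} \<le> measure_pmf.prob nu {k..}"
proof -
  have "measure_pmf.prob mu {k..} \<le> measure_pmf.prob nu {y. \<exists>x\<in>{k..}. x \<le> y}"
    by (rule rel_pmf_measureD[OF assms])
  also have "{y. \<exists>x\<in>{k..}. x \<le> y} = {k..}" by auto
  finally show ?thesis .
qed

lemma pmf_0_antimono:
  assumes "rel_pmf (\<le>) mu (nu :: nat pmf)"
  shows "pmf nu 0 \<le> pmf mu 0"
proof -
  have eq: "pmf rho 0 = 1 - measure_pmf.prob rho {1..}" for rho :: "nat pmf"
  proof -
    have "measure_pmf.prob rho {1..} = measure_pmf.prob rho (UNIV - {0})"
      by (intro arg_cong[where f = "measure_pmf.prob rho"]) auto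
    also have "\<dots> = 1 - pmf rho 0"
      using measure_pmf.prob_compl[of "{0}" rho] by (simp add: measure_pmf_single)
    finally show ?thesis by simp
  qed
  show ?thesis
    using measure_pmf_mono_le[OF assms, of 1] by (simp add: eq)
qed

lemma pmf_mean_mono:
  assumes "rel_pmf (\<le>) mu nu"
  shows "pmf_mean mu \<le> pmf_mean nu"
proof -
  from assms obtain pq where pq: "\<And>x y. (x, y) \<in> set_pmf pq \<Longrightarrow> x \<le> y"
      "map_pmf fst pq = mu" "map_pmf snd pq = nu"
    by (auto elim: rel_pmf.cases)
  have "pmf_mean mu = (\<integral>\<^sup>+z. ennreal (real (fst z)) \<partial>pq)"
    by (simp add: pmf_mean_def flip: pq(2))
  also have "\<dots> \<le> (\<integral>\<^sup>+z. ennreal (real (snd z)) \<partial>pq)"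
    by (intro nn_integral_mono_AE) (auto simp: AE_measure_pmf_iff intro!: ennreal_leI pq(1))
  also have "\<dots> = pmf_mean nu"
    by (simp add: pmf_mean_def flip: pq(3))
  finally show ?thesis .
qed

text \<open>\<open>rs_step\<close> is \<open>m\<close>-Lipschitz for ordered laws, since the atom at \<open>0\<close> decreases.\<close>

lemma mean_rs_law_diff_le:
  assumes "m \<ge> 2" "rel_pmf (\<le>) nu mu" "pmf_mean mu < top"
  shows "rs.mean m mu n - rs.mean m nu n \<le> real m ^ n * (rs.mean m mu 0 - rs.mean m nu 0)"
proof -
  interpret mu: rs m mu by unfold_locales (use assms in auto)
  interpret nu: rs m nu
    by unfold_locales (use assms pmf_mean_mono[OF assms(2)] in \<open>auto intro: le_less_trans\<close>)
  show ?thesis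
  proof (induction n)
    case (Suc n)
    have "pmf (rs_law m mu n) 0 ^ m \<le> pmf (rs_law m nu n) 0 ^ m"
      by (intro power_mono pmf_0_antimono rs_law_mono assms) auto
    then have "mu.mean (Suc n) - nu.mean (Suc n) \<le> real m * (mu.mean n - nu.mean n)"
      by (simp add: mu.mean_Suc nu.mean_Suc algebra_simps)
    also have "\<dots> \<le> real m * (real m ^ n * (mu.mean 0 - nu.mean 0))"
      by (intro mult_left_mono Suc) auto
    finally show ?case by (simp add: mult.assoc)
  qed simp
qed

section \<open>The drift\<close>

lemma expectation_finite_mono:
  fixes f g :: "'a \<Rightarrow> real"
  assumes "finite (set_pmf mu)" "\<And>x. x \<in> set_pmf mu \<Longrightarrow> f x \<le> g x"
  shows "measure_pmf.expectation mu f \<le> measure_pmf.expectation mu g"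
  using assms by (intro integral_mono_AE integrable_measure_pmf_finite) (auto simp: AE_measure_pmf_iff)

lemma expectation_bind_finite:
  fixes h :: "'b \<Rightarrow> real"
  assumes "finite (set_pmf p)" "\<And>x. x \<in> set_pmf p \<Longrightarrow> finite (set_pmf (f x))"
  shows "measure_pmf.expectation (bind_pmf p f) h
       = measure_pmf.expectation p (\<lambda>x. measure_pmf.expectation (f x) h)"
  using assms
  by (subst pmf_expectation_bind[of "set_pmf p"], simp_all)
     (subst integral_measure_pmf_real[of "set_pmf p"], auto simp: mult.commute)

lemma finite_set_sum_iid: "finite (set_pmf mu) \<Longrightarrow> finite (set_pmf (sum_iid k mu))"
  by (induction k) auto

lemma finite_set_rs_step: "finite (set_pmf mu) \<Longrightarrow> finite (set_pmf (rs_step m mu))"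
  by (simp add: rs_step_def finite_set_sum_iid)

lemma finite_set_rs_law: "finite (set_pmf mu) \<Longrightarrow> finite (set_pmf (rs_law m mu n))"
  by (induction n) (auto simp: rs_law_Suc finite_set_rs_step)

lemma expectation_sum_iid_Suc:
  fixes h :: "nat \<Rightarrow> real"
  assumes "finite (set_pmf mu)"
  shows "measure_pmf.expectation (sum_iid (Suc k) mu) h
       = measure_pmf.expectation mu (\<lambda>x. measure_pmf.expectation (sum_iid k mu) (\<lambda>y. h (x + y)))"
  using assms by (simp add: expectation_bind_finite finite_set_sum_iid)

definition pgf :: "real \<Rightarrow> nat pmf \<Rightarrow> real" where
  "pgf s mu = measure_pmf.expectation mu (\<lambda>x. s ^ x)"

text \<open>With G the generating function this is s (s - 1) G'(s) - G(s). For the mixed law at s =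
  m, solving \<open>drift\<close> = 0 for p yields the explicit formula for the threshold.\<close>

definition drift :: "real \<Rightarrow> nat pmf \<Rightarrow> real" where
  "drift s mu = measure_pmf.expectation mu (\<lambda>x. ((s - 1) * real x - 1) * s ^ x)"

lemma pgf_sum_iid: "finite (set_pmf mu) \<Longrightarrow> pgf s (sum_iid k mu) = pgf s mu ^ k"
proof (induction k)
  case (Suc k)
  then show ?case
    by (simp add: pgf_def expectation_sum_iid_Suc power_add del: sum_iid.simps)
qed (simp add: pgf_def)

text \<open>This is s d/ds applied to G^k; the induction peels off one copy. At k = 0 the factor
  \<open>real k\<close> makes the truncated exponent harmless.\<close>

lemma expectation_times_power_sum_iid:
  assumes "finite (set_pmf mu)"
  shows "measure_pmf.expectation (sum_iid k mu) (\<lambda>x. real x * s ^ x)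
       = real k * pgf s mu ^ (k - 1) * measure_pmf.expectation mu (\<lambda>x. real x * s ^ x)"
proof (induction k)
  case (Suc k)
  let ?H = "measure_pmf.expectation mu (\<lambda>x. real x * s ^ x)"
  let ?Hk = "measure_pmf.expectation (sum_iid k mu) (\<lambda>x. real x * s ^ x)"
  note int = integrable_measure_pmf_finite[OF assms]
    integrable_measure_pmf_finite[OF finite_set_sum_iid[OF assms]]
  have inner: "measure_pmf.expectation (sum_iid k mu) (\<lambda>y. real (x + y) * s ^ (x + y))
      = real x * s ^ x * pgf s mu ^ k + s ^ x * ?Hk" for x
  proof -
    have "measure_pmf.expectation (sum_iid k mu) (\<lambda>y. real (x + y) * s ^ (x + y))
        = measure_pmf.expectation (sum_iid k mu) (\<lambda>y. (real x * s ^ x) * s ^ y + s ^ x * (real y * s ^ y))"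
      by (intro Bochner_Integration.integral_cong) (auto simp: power_add algebra_simps)
    also have "\<dots> = (real x * s ^ x) * pgf s (sum_iid k mu) + s ^ x * ?Hk"
      by (simp add: int pgf_def)
    finally show ?thesis using assms by (simp add: pgf_sum_iid)
  qed
  have "measure_pmf.expectation (sum_iid (Suc k) mu) (\<lambda>x. real x * s ^ x)
      = measure_pmf.expectation mu (\<lambda>x. real x * s ^ x * pgf s mu ^ k + s ^ x * ?Hk)"
    by (simp only: expectation_sum_iid_Suc[OF assms] inner)
  also have "\<dots> = ?H * pgf s mu ^ k + pgf s mu * ?Hk"
    by (simp add: int pgf_def)
  also have "\<dots> = real (Suc k) * pgf s mu ^ k * ?H"
    unfolding Suc by (cases k) (auto simp: algebra_simps)
  finally show ?case by simp
qed simp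

text \<open>At s = m only a nonnegative multiple of \<open>drift s mu\<close> remains, so its sign
  is preserved. For 1 <= s < m the factor m / s amplifies a positive drift and the second summand
  adds a further gain.\<close>

lemma drift_rs_step:
  assumes "finite (set_pmf mu)" "s > 0" "m \<ge> 1"
  shows "drift s (rs_step m mu)
       = pgf s mu ^ (m - 1) * (real m / s * drift s mu + (real m / s - 1) * pgf s mu)"
proof -
  let ?H = "\<lambda>mu. measure_pmf.expectation mu (\<lambda>x. real x * s ^ x)"
  note int = integrable_measure_pmf_finite[OF assms(1)]
    integrable_measure_pmf_finite[OF finite_set_sum_iid[OF assms(1)]]
  \<comment> \<open>The weight in \<open>drift\<close> is tailored to this identity: at x = 0, where
    the subtraction truncates, both sides equal -1, so no correction from the atom at 0
    appears.\<close>
  have pt: "((s - 1) * real (x - 1) - 1) * s ^ (x - 1) = (s - 1) / s * (real x * s ^ x) - s ^ x" for x :: nat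
    using assms(2) by (cases x) (auto simp: field_simps)
  have D: "drift s mu = (s - 1) * ?H mu - pgf s mu"
    by (simp add: drift_def pgf_def int left_diff_distrib mult.assoc)
  have "drift s (rs_step m mu)
      = measure_pmf.expectation (sum_iid m mu) (\<lambda>x. (s - 1) / s * (real x * s ^ x) - s ^ x)"
    unfolding drift_def rs_step_def integral_map_pmf pt ..
  also have "\<dots> = (s - 1) / s * ?H (sum_iid m mu) - pgf s (sum_iid m mu)"
    by (simp add: int pgf_def)
  also have "\<dots> = (s - 1) / s * (real m * pgf s mu ^ (m - 1) * ?H mu) - pgf s mu ^ m"
    using assms(1) by (simp add: pgf_sum_iid expectation_times_power_sum_iid)
  also have "pgf s mu ^ m = pgf s mu ^ (m - 1) * pgf s mu"
    using assms(3) by (cases m) auto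
  also have "(s - 1) / s * (real m * pgf s mu ^ (m - 1) * ?H mu) - pgf s mu ^ (m - 1) * pgf s mu
      = pgf s mu ^ (m - 1) * (real m / s * drift s mu + (real m / s - 1) * pgf s mu)"
    using assms(2) unfolding D by (simp add: field_simps)
  finally show ?thesis .
qed

lemma pgf_ge_1:
  assumes "finite (set_pmf mu)" "s \<ge> 1"
  shows "pgf s mu \<ge> 1"
  using expectation_finite_mono[OF assms(1), of "\<lambda>_. 1" "\<lambda>x. s ^ x"] assms(2)
  by (simp add: pgf_def)

lemma drift_rs_law_nonpos:
  assumes "finite (set_pmf mu)" "m \<ge> 1" "drift (real m) mu \<le> 0"
  shows "drift (real m) (rs_law m mu n) \<le> 0"
proof (induction n)
  case (Suc n)
  have "pgf (real m) (rs_law m mu n) \<ge> 0"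
    using pgf_ge_1[OF finite_set_rs_law[OF assms(1)], of "real m"] assms(2) by (smt (verit) of_nat_1 of_nat_le_iff)
  then show ?case
    using assms Suc by (simp add: rs_law_Suc drift_rs_step finite_set_rs_law mult_nonneg_nonpos)
qed (use assms in simp)

lemma pmf_mean_finite_support:
  assumes "finite (set_pmf mu)"
  shows "pmf_mean mu = ennreal (measure_pmf.expectation mu real)"
  unfolding pmf_mean_def
  by (rule nn_integral_eq_integral) (auto simp: integrable_measure_pmf_finite assms)

text \<open>Replacing m^x by 1 can only lower the integrand: its bracket is nonnegative for x >= 1,
  and at x = 0 the power is already 1. What remains is (m - 1) E[X] - 1 <= 0.\<close>

lemma mean_le_of_drift_nonpos:
  assumes "finite (set_pmf mu)" "m \<ge> 2" "drift (real m) mu \<le> 0"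
  shows "enn2real (pmf_mean mu) \<le> 1"
proof -
  have "(real m - 1) * real x - 1 \<le> ((real m - 1) * real x - 1) * real m ^ x" for x
  proof (cases x)
    case (Suc y)
    have "1 * 1 \<le> (real m - 1) * real x"
      using assms(2) Suc by (intro mult_mono) auto
    moreover have "real m ^ x \<ge> 1" using assms(2) by simp
    ultimately show ?thesis
      by (metis diff_ge_0_iff_ge mult.right_neutral mult_left_mono)
  qed simp
  then have "measure_pmf.expectation mu (\<lambda>x. (real m - 1) * real x - 1) \<le> drift (real m) mu"
    unfolding drift_def by (intro expectation_finite_mono assms)
  then have "(real m - 1) * measure_pmf.expectation mu real \<le> 1"
    using assms(3) by (simp add: integrable_measure_pmf_finite assms(1))
  moreover have "1 * measure_pmf.expectation mu real \<le> (real m - 1) * measure_pmf.expectation mu real"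
    using assms(2) by (intro mult_right_mono) auto
  ultimately show ?thesis
    using assms(1) by (simp add: pmf_mean_finite_support)
qed

text \<open>The system started from the truncated law keeps all means at most 1, and the full system
  exceeds it at generation n by at most m^n B. Dividing by m^n and letting n grow leaves B.\<close>

lemma free_energy_le_tail_mean:
  assumes "m \<ge> 2" "pmf_mean mu < top" "drift (real m) (trunc_pmf L mu) \<le> 0" "B \<ge> 0"
    and B: "(\<integral>\<^sup>+x. ennreal (real x) * indicator {L<..} x \<partial>mu) \<le> ennreal B"
  shows "free_energy m mu \<le> B"
proof -
  let ?nu = "trunc_pmf L mu"
  interpret mu: rs m mu by unfold_locales (use assms in auto)
  interpret nu: rs m ?nu
    by unfold_locales (use assms pmf_mean_mono[OF trunc_pmf_le] in \<open>auto intro: le_less_trans\<close>)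
  have *: "ennreal (real x) = ennreal (real (if x \<le> L then x else 0)) + ennreal (real x) * indicator {L<..} x"
    for x by (auto simp: indicator_def)
  have "pmf_mean mu = (\<integral>\<^sup>+x. ennreal (real (if x \<le> L then x else 0)) + ennreal (real x) * indicator {L<..} x \<partial>mu)"
    unfolding pmf_mean_def by (intro nn_integral_cong *)
  also have "\<dots> = pmf_mean ?nu + (\<integral>\<^sup>+x. ennreal (real x) * indicator {L<..} x \<partial>mu)"
    by (subst nn_integral_add) (auto simp: pmf_mean_def trunc_pmf_def)
  also have "\<dots> \<le> pmf_mean ?nu + ennreal B"
    by (intro add_left_mono B)
  finally have "ennreal (mu.mean 0) \<le> ennreal (nu.mean 0 + B)"
    using mu.ennreal_mean[of 0] nu.ennreal_mean[of 0] nu.mean_nonneg[of 0] assms(4) by simp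
  then have 0: "mu.mean 0 - nu.mean 0 \<le> B"
    using nu.mean_nonneg[of 0] assms(4) by (subst (asm) ennreal_le_iff) auto
  have nu1: "nu.mean n \<le> 1" for n
    unfolding nu.mean_def using assms(1,3)
    by (intro mean_le_of_drift_nonpos[of _ m] drift_rs_law_nonpos finite_set_rs_law) auto
  have bound: "mu.mean n / real m ^ n \<le> B + 1 / real m ^ n" for n
  proof -
    have "mu.mean n \<le> 1 + real m ^ n * B"
      using mean_rs_law_diff_le[OF assms(1) trunc_pmf_le assms(2), of n L] nu1[of n]
        mult_left_mono[OF 0, of "real m ^ n"] by simp
    then show ?thesis
      using assms(1) by (simp add: field_simps)
  qed
  have "(\<lambda>n. B + (1 / real m) ^ n) \<longlonglongrightarrow> B + 0"
    using assms(1) by (intro tendsto_intros LIMSEQ_power_zero) auto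
  then show ?thesis
    using tendsto_le[OF sequentially_bot _ mu.free_energy_limit, of "\<lambda>n. B + 1 / real m ^ n" B] bound
    by (simp add: power_divide)
qed

section \<open>Growth of the drift in the supercritical regime\<close>

lemma prob_sum_iid_atMost_le:
  "measure_pmf.prob (sum_iid k mu) {..r} \<le> measure_pmf.prob mu {..r} ^ k"
proof (induction k)
  case (Suc k)
  have "emeasure (sum_iid (Suc k) mu) {..r}
      = (\<integral>\<^sup>+x. emeasure (map_pmf ((+) x) (sum_iid k mu)) {..r} \<partial>mu)"
    by simp
  also have "\<dots> \<le> (\<integral>\<^sup>+x. emeasure (sum_iid k mu) {..r} * indicator {..r} x \<partial>mu)"
  proof (intro nn_integral_mono)
    fix x :: nat
    have "(+) x -` {..r} \<subseteq> (if x \<le> r then {..r} else {})"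
      by auto
    then have "emeasure (sum_iid k mu) ((+) x -` {..r}) \<le> emeasure (sum_iid k mu) (if x \<le> r then {..r} else {})"
      by (intro emeasure_mono) auto
    then show "emeasure (map_pmf ((+) x) (sum_iid k mu)) {..r}
        \<le> emeasure (sum_iid k mu) {..r} * indicator {..r} x"
      by (auto simp: indicator_def split: if_splits)
  qed
  also have "\<dots> = emeasure (sum_iid k mu) {..r} * emeasure mu {..r}"
    by (simp add: nn_integral_cmult)
  finally have "measure_pmf.prob (sum_iid (Suc k) mu) {..r}
      \<le> measure_pmf.prob (sum_iid k mu) {..r} * measure_pmf.prob mu {..r}"
    by (simp add: measure_pmf.emeasure_eq_measure flip: ennreal_mult')
  also have "\<dots> \<le> measure_pmf.prob mu {..r} ^ k * measure_pmf.prob mu {..r}"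
    by (intro mult_right_mono Suc) auto
  finally show ?case by (simp add: mult.commute)
qed simp

text \<open>Each step subtracts at most one from a sum of nonnegative terms. A value at most r after
  j steps therefore forces all m^j independent ancestors to be at most r + j.\<close>

lemma prob_rs_law_atMost_le:
  "measure_pmf.prob (rs_law m mu (n + j)) {..r} \<le> measure_pmf.prob (rs_law m mu n) {..r + j} ^ (m ^ j)"
proof (induction j arbitrary: r)
  case (Suc j)
  let ?nu = "rs_law m mu (n + j)"
  have "measure_pmf.prob (rs_step m ?nu) {..r} = measure_pmf.prob (sum_iid m ?nu) ((\<lambda>s. s - 1) -` {..r})"
    by (simp add: rs_step_def)
  also have "(\<lambda>s. s - 1) -` {..r} = {..Suc r}"
    by auto
  also have "measure_pmf.prob (sum_iid m ?nu) {..Suc r} \<le> measure_pmf.prob ?nu {..Suc r} ^ m"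
    by (rule prob_sum_iid_atMost_le)
  also have "\<dots> \<le> (measure_pmf.prob (rs_law m mu n) {..Suc r + j} ^ (m ^ j)) ^ m"
    by (intro power_mono Suc) auto
  finally show ?case
    by (simp add: rs_law_Suc mult.commute flip: power_mult)
qed simp

lemma prob_atLeast_le_mean:
  assumes "pmf_mean mu \<le> ennreal a" "a \<ge> 0" "k > 0"
  shows "measure_pmf.prob mu {k..} \<le> a / real k"
proof -
  have "ennreal (real k) * emeasure mu {k..} = (\<integral>\<^sup>+x. ennreal (real k) * indicator {k..} x \<partial>mu)"
    by (simp add: nn_integral_cmult)
  also have "\<dots> \<le> pmf_mean mu"
    unfolding pmf_mean_def by (intro nn_integral_mono) (auto simp: indicator_def intro: ennreal_leI)
  finally have "ennreal (real k * measure_pmf.prob mu {k..}) \<le> ennreal a"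
    using assms(1) by (simp add: measure_pmf.emeasure_eq_measure ennreal_mult')
  then show ?thesis
    using assms by (subst (asm) ennreal_le_iff) (auto simp: field_simps)
qed

lemma prob_atLeast_Suc: "measure_pmf.prob mu {Suc k..} = 1 - measure_pmf.prob mu {..k}"
proof -
  have "{Suc k..} = UNIV - {..k}" by auto
  then show ?thesis
    using measure_pmf.prob_compl[of "{..k}" mu] by simp
qed

text \<open>A value \<open>k\<close> at one of the \<open>m ^ j\<close> ancestors survives \<open>j\<close> steps as a value at least \<open>k - j\<close>,
  so tails heavier than \<open>m ^ - k\<close> would force a large mean \<open>k - 4\<close> generations later.\<close>

lemma (in rs) prob_rs_law_atLeast_le:
  assumes "\<And>j. j + 4 \<le> k \<Longrightarrow> mean (n + j) \<le> 2"
  shows "measure_pmf.prob (rs_law m mu n) {k..} \<le> real m ^ 4 / real m ^ k"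
proof (cases "k \<le> 4")
  case True
  then have "real m ^ k \<le> real m ^ 4"
    using m_ge_2 by (intro power_increasing) auto
  then have "1 \<le> real m ^ 4 / real m ^ k"
    using m_ge_2 by simp
  then show ?thesis
    by (rule order_trans[OF measure_pmf.prob_le_1])
next
  case False
  \<comment> \<open>At level 4 Markov's inequality with mean at most 2 gives probability at most
    1/2. Hence 1/2 <= (1 - q)^(m^j) <= exp(- m^j q), and ln 2 < 1 yields m^j q <= 1.\<close>
  define j where "j = k - 4"
  have k: "k = Suc (3 + j)" using False by (simp add: j_def)
  define q where "q = measure_pmf.prob (rs_law m mu n) {k..}"
  have "pmf_mean (rs_law m mu (n + j)) \<le> ennreal 2"
    unfolding ennreal_mean[symmetric] using assms[of j] k by (intro ennreal_leI) simp
  then have "measure_pmf.prob (rs_law m mu (n + j)) {4..} \<le> 2 / real 4"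
    by (intro prob_atLeast_le_mean) auto
  then have "1 / 2 \<le> measure_pmf.prob (rs_law m mu (n + j)) {..3}"
    using prob_atLeast_Suc[of "rs_law m mu (n + j)" 3] by simp
  also have "\<dots> \<le> measure_pmf.prob (rs_law m mu n) {..3 + j} ^ (m ^ j)"
    by (rule prob_rs_law_atMost_le)
  also have "measure_pmf.prob (rs_law m mu n) {..3 + j} = 1 - q"
    using prob_atLeast_Suc[of "rs_law m mu n" "3 + j"] by (simp add: q_def k)
  also have "(1 - q) ^ (m ^ j) \<le> exp (- q) ^ (m ^ j)"
    using exp_ge_add_one_self[of "- q"] by (intro power_mono) (auto simp: q_def)
  also have "\<dots> = exp (- (real m ^ j * q))"
    by (simp flip: exp_of_nat_mult)
  finally have "ln (1 / 2) \<le> - (real m ^ j * q)"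
    by (metis exp_gt_zero ln_exp ln_mono zero_less_divide_1_iff zero_less_numeral)
  then have "real m ^ j * q \<le> 1"
    using ln_2_less_1 by (simp add: ln_div)
  then have "q \<le> 1 / real m ^ j"
    using m_ge_2 by (simp add: field_simps)
  also have "\<dots> = real m ^ 4 / real m ^ k"
    using m_ge_2 by (simp add: k power_add field_simps eval_nat_numeral)
  finally show ?thesis by (simp add: q_def)
qed

text \<open>One step can enlarge the support from {..K} to {..m * K}, so the truncation is repeated
  after each step.\<close>

primrec trunc_law :: "nat \<Rightarrow> nat \<Rightarrow> nat pmf \<Rightarrow> nat \<Rightarrow> nat pmf" where
  "trunc_law m K mu 0 = trunc_pmf K mu"
| "trunc_law m K mu (Suc n) = trunc_pmf K (rs_step m (trunc_law m K mu n))"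

lemma set_pmf_trunc_law: "set_pmf (trunc_law m K mu n) \<subseteq> {..K}"
  by (cases n) (auto simp: set_pmf_trunc_pmf dest!: subsetD[OF set_pmf_trunc_pmf])

lemma finite_set_trunc_law [simp]: "finite (set_pmf (trunc_law m K mu n))"
  by (rule finite_subset[OF set_pmf_trunc_law]) simp

lemma trunc_law_le: "rel_pmf (\<le>) (trunc_law m K mu n) (rs_law m mu n)"
proof (induction n)
  case (Suc n)
  show ?case
    using rel_pmf_le_trans[OF trunc_pmf_le rs_step_mono[OF Suc]] by (simp add: rs_law_Suc)
qed (simp add: trunc_pmf_le)

text \<open>The power m^x is one of the terms m^k with k <= x, and the tail bound makes every m^k
  P(Y >= k) at most m^4. Estimating the tail at level k <= K looks fewer than K generations ahead or
  none, whence the horizon n + K.\<close>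

lemma (in rs) pgf_trunc_law_le:
  assumes "\<And>i. i \<le> n + K \<Longrightarrow> mean i \<le> 2"
  shows "pgf (real m) (trunc_law m K mu n) \<le> real m ^ 4 * (real K + 1)"
proof -
  let ?Y = "trunc_law m K mu n"
  have "pgf (real m) ?Y \<le> measure_pmf.expectation ?Y (\<lambda>x. \<Sum>k\<le>K. real m ^ k * indicator {k..} x)"
    unfolding pgf_def
  proof (rule expectation_finite_mono)
    fix x assume "x \<in> set_pmf ?Y"
    then have "x \<le> K" using set_pmf_trunc_law[of m K mu n] by auto
    then show "real m ^ x \<le> (\<Sum>k\<le>K. real m ^ k * indicator {k..} x)"
      using member_le_sum[of x "{..K}" "\<lambda>k. real m ^ k * indicator {k..} x"] by auto
  qed simp
  also have "\<dots> = (\<Sum>k\<le>K. real m ^ k * measure_pmf.prob ?Y {k..})"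
    by (subst Bochner_Integration.integral_sum) (auto intro: integrable_measure_pmf_finite)
  also have "\<dots> \<le> (\<Sum>k\<le>K. real m ^ 4)"
  proof (rule sum_mono)
    fix k assume "k \<in> {..K}"
    then have "measure_pmf.prob (rs_law m mu n) {k..} \<le> real m ^ 4 / real m ^ k"
      by (intro prob_rs_law_atLeast_le assms) auto
    then have "measure_pmf.prob ?Y {k..} \<le> real m ^ 4 / real m ^ k"
      by (rule order_trans[OF measure_pmf_mono_le[OF trunc_law_le]])
    then show "real m ^ k * measure_pmf.prob ?Y {k..} \<le> real m ^ 4"
      using m_ge_2 by (simp add: field_simps)
  qed
  finally show ?thesis by (simp add: algebra_simps)
qed

section \<open>Drift under repeated truncation\<close>

lemma set_pmf_sum_iid_atMost: "set_pmf mu \<subseteq> {..K} \<Longrightarrow> set_pmf (sum_iid k mu) \<subseteq> {..k * K}"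
  by (induction k) (fastforce intro: add_mono)+

text \<open>A discarded x exceeds K, so s^x <= (1 - e)^K m^x. Measuring the drift at s < m while
  controlling moments at m makes the truncation loss small.\<close>

lemma drift_trunc_pmf_ge:
  fixes e :: real
  assumes e: "0 \<le> e" "e \<le> 1 / 2" and m: "m \<ge> 2" and nu: "set_pmf nu \<subseteq> {..m * K}"
  defines "s \<equiv> real m * (1 - e)"
  shows "drift s nu - real m * (real m * real K) * (1 - e) ^ K * pgf (real m) nu \<le> drift s (trunc_pmf K nu)"
proof -
  have fin: "finite (set_pmf nu)"
    by (rule finite_subset[OF nu]) simp
  note int = integrable_measure_pmf_finite[OF fin]
  let ?c = "real m * (real m * real K) * (1 - e) ^ K"
  have "2 * (1 / 2) \<le> s"
    unfolding s_def using m e by (intro mult_mono) auto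
  then have s1: "s \<ge> 1" by simp
  have sm: "s \<le> real m"
    using e m unfolding s_def by (simp add: mult_left_le)
  have pt: "((s - 1) * real x - 1) * s ^ x - ?c * real m ^ x
      \<le> ((s - 1) * real (if x \<le> K then x else 0) - 1) * s ^ (if x \<le> K then x else 0)"
    if "x \<in> set_pmf nu" for x
  proof (cases "x \<le> K")
    case True
    then show ?thesis using e by simp
  next
    case False
    have "x \<le> m * K" using nu that by auto
    then have x: "real x \<le> real m * real K" by (metis of_nat_le_iff of_nat_mult)
    have "(1 - e) ^ x \<le> (1 - e) ^ K"
      using e False by (intro power_decreasing) auto
    then have sx: "s ^ x \<le> (1 - e) ^ K * real m ^ x"
      unfolding s_def power_mult_distrib by (simp add: mult.commute mult_left_mono)
    have "((s - 1) * real x) * s ^ x \<le> (real m * (real m * real K)) * ((1 - e) ^ K * real m ^ x)"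
      using s1 sm x sx e by (intro mult_mono) auto
    \<comment> \<open>Once sent to 0, the value contributes -1, which the summand -s^x on the left
      covers.\<close>
    moreover have "s ^ x \<ge> 1" using s1 by simp
    ultimately show ?thesis using False by (simp add: algebra_simps)
  qed
  have "drift s nu - ?c * pgf (real m) nu
      = measure_pmf.expectation nu (\<lambda>x. ((s - 1) * real x - 1) * s ^ x - ?c * real m ^ x)"
    unfolding drift_def pgf_def by (subst Bochner_Integration.integral_diff) (auto intro: int)
  also have "\<dots> \<le> measure_pmf.expectation nu (\<lambda>x. ((s - 1) * real (if x \<le> K then x else 0) - 1)
      * s ^ (if x \<le> K then x else 0))"
    by (intro expectation_finite_mono fin pt)
  also have "\<dots> = drift s (trunc_pmf K nu)"
    by (simp add: drift_def trunc_pmf_def)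
  finally show ?thesis .
qed

lemma pgf_rs_step_le:
  assumes "finite (set_pmf mu)" "s \<ge> 1"
  shows "pgf s (rs_step m mu) \<le> pgf s mu ^ m"
proof -
  have "pgf s (rs_step m mu) = measure_pmf.expectation (sum_iid m mu) (\<lambda>x. s ^ (x - 1))"
    by (simp add: pgf_def rs_step_def)
  also have "\<dots> \<le> pgf s (sum_iid m mu)"
    unfolding pgf_def using assms
    by (intro expectation_finite_mono finite_set_sum_iid power_increasing) auto
  finally show ?thesis using assms by (simp add: pgf_sum_iid)
qed

text \<open>Since m / s = 1 / (1 - e) >= 1 + e and the generating function is at least 1, the
  untruncated step gains a spare e beyond the factor 1 + e. By \<open>loss\<close> this spare e pays
  for the truncation.\<close>

lemma drift_trunc_step_ge:
  fixes e :: real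
  assumes e: "0 \<le> e" "e \<le> 1 / 2" and m: "m \<ge> 2" and Y: "set_pmf Y \<subseteq> {..K}"
    and G: "pgf (real m) Y \<le> g"
    and loss: "real m * (real m * real K) * (1 - e) ^ K * g ^ m \<le> e"
    and D: "drift (real m * (1 - e)) Y \<ge> 0"
  shows "(1 + e) * drift (real m * (1 - e)) Y \<le> drift (real m * (1 - e)) (trunc_pmf K (rs_step m Y))"
proof -
  define s where "s = real m * (1 - e)"
  have fin: "finite (set_pmf Y)"
    by (rule finite_subset[OF Y]) simp
  have "2 * (1 / 2) \<le> s"
    unfolding s_def using m e by (intro mult_mono) auto
  then have s1: "s \<ge> 1" by simp
  have ms: "1 + e \<le> real m / s"
  proof -
    have "(1 + e) * s = real m * (1 - e ^ 2)"
      by (simp add: s_def power2_eq_square algebra_simps)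
    also have "\<dots> \<le> real m" by (simp add: mult_left_le)
    finally show ?thesis using s1 by (simp add: field_simps)
  qed
  have G1: "pgf s Y \<ge> 1" by (rule pgf_ge_1[OF fin s1])
  have gain: "(1 + e) * drift s Y + e \<le> real m / s * drift s Y + (real m / s - 1) * pgf s Y"
  proof (rule add_mono)
    show "(1 + e) * drift s Y \<le> real m / s * drift s Y"
      using D ms by (intro mult_right_mono) (auto simp: s_def)
    have "e * 1 \<le> (real m / s - 1) * pgf s Y"
      using ms G1 e by (intro mult_mono) auto
    then show "e \<le> (real m / s - 1) * pgf s Y" by simp
  qed
  also have "real m / s * drift s Y + (real m / s - 1) * pgf s Y
      \<le> pgf s Y ^ (m - 1) * (real m / s * drift s Y + (real m / s - 1) * pgf s Y)"
  proof -
    have "0 \<le> (1 + e) * drift s Y + e" using D e by (simp add: s_def)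
    also note gain
    finally show ?thesis
      using mult_right_mono[OF one_le_power[OF G1, of "m - 1"]] by fastforce
  qed
  also have "\<dots> = drift s (rs_step m Y)"
    using fin s1 m by (simp add: drift_rs_step)
  also have "\<dots> \<le> drift s (trunc_pmf K (rs_step m Y)) + e"
  proof -
    have "set_pmf (rs_step m Y) \<subseteq> {..m * K}"
      using set_pmf_sum_iid_atMost[OF Y, of m] by (fastforce simp: rs_step_def)
    then have "drift s (rs_step m Y) - real m * (real m * real K) * (1 - e) ^ K * pgf (real m) (rs_step m Y)
        \<le> drift s (trunc_pmf K (rs_step m Y))"
      unfolding s_def by (intro drift_trunc_pmf_ge e m)
    moreover have "real m * (real m * real K) * (1 - e) ^ K * pgf (real m) (rs_step m Y)
        \<le> real m * (real m * real K) * (1 - e) ^ K * g ^ m"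
    proof (intro mult_left_mono)
      have "pgf (real m) (rs_step m Y) \<le> pgf (real m) Y ^ m"
        using m by (intro pgf_rs_step_le fin) auto
      also have "\<dots> \<le> g ^ m"
        using pgf_ge_1[OF fin, of "real m"] m G by (intro power_mono) auto
      finally show "pgf (real m) (rs_step m Y) \<le> g ^ m" .
    qed (use e in auto)
    ultimately show ?thesis using loss by linarith
  qed
  finally show ?thesis by (simp add: s_def)
qed

lemma drift_le_pgf:
  assumes Y: "set_pmf Y \<subseteq> {..K}" and "1 \<le> s" "s \<le> real m"
  shows "drift s Y \<le> real m * real K * pgf (real m) Y"
proof -
  have fin: "finite (set_pmf Y)"
    by (rule finite_subset[OF Y]) simp
  have "drift s Y \<le> measure_pmf.expectation Y (\<lambda>x. real m * real K * real m ^ x)"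
    unfolding drift_def
  proof (rule expectation_finite_mono[OF fin])
    fix x assume "x \<in> set_pmf Y"
    then have "x \<le> K" using Y by auto
    have "((s - 1) * real x - 1) * s ^ x \<le> ((s - 1) * real x) * s ^ x"
      using assms by (intro mult_right_mono) auto
    also have "\<dots> \<le> (real m * real K) * real m ^ x"
      using assms \<open>x \<le> K\<close> by (intro mult_mono power_mono) auto
    finally show "((s - 1) * real x - 1) * s ^ x \<le> real m * real K * real m ^ x" .
  qed
  then show ?thesis by (simp add: pgf_def)
qed

text \<open>The time 2K consists of K steps in which the drift grows to (1 + e)^K d, and K
  generations of look-ahead for the tail estimate. By \<open>growth\<close> the drift would then
  exceed what a law on {..K} with that tail estimate allows.\<close>

lemma (in rs) exists_mean_gt_2:
  fixes e d :: real
  assumes e: "0 \<le> e" "e \<le> 1 / 2" and d: "d > 0"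
    and D0: "drift (real m * (1 - e)) (trunc_pmf K mu) \<ge> d"
    and loss: "real m * (real m * real K) * (1 - e) ^ K * (real m ^ 4 * (real K + 1)) ^ m \<le> e"
    and growth: "real m * real K * (real m ^ 4 * (real K + 1)) < (1 + e) ^ K * d"
  shows "\<exists>n\<le>2 * K. mean n > 2"
proof (rule ccontr)
  assume "\<not> ?thesis"
  then have le2: "mean n \<le> 2" if "n \<le> 2 * K" for n
    using that by (meson not_le)
  let ?s = "real m * (1 - e)" and ?g = "real m ^ 4 * (real K + 1)"
  have G: "pgf (real m) (trunc_law m K mu n) \<le> ?g" if "n \<le> K" for n
    using that by (intro pgf_trunc_law_le le2) auto
  have D: "(1 + e) ^ n * d \<le> drift ?s (trunc_law m K mu n)" if "n \<le> K" for n
    using that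
  proof (induction n)
    case (Suc n)
    have IH: "(1 + e) ^ n * d \<le> drift ?s (trunc_law m K mu n)"
      using Suc by simp
    have "(1 + e) ^ Suc n * d = (1 + e) * ((1 + e) ^ n * d)" by simp
    also have "\<dots> \<le> (1 + e) * drift ?s (trunc_law m K mu n)"
      using e by (intro mult_left_mono IH) auto
    also have "\<dots> \<le> drift ?s (trunc_law m K mu (Suc n))"
    proof -
      have "0 \<le> (1 + e) ^ n * d" using e d by simp
      then have "0 \<le> drift ?s (trunc_law m K mu n)" using IH by linarith
      then show ?thesis
        unfolding trunc_law.simps using G[of n] Suc.prems
        by (intro drift_trunc_step_ge[OF e m_ge_2 set_pmf_trunc_law _ loss]) auto
    qed
    finally show ?case .
  qed (use D0 in simp)
  have "2 * (1 / 2) \<le> ?s"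
    using m_ge_2 e by (intro mult_mono) auto
  moreover have "?s \<le> real m" using e by (simp add: mult_left_le)
  ultimately have "drift ?s (trunc_law m K mu K) \<le> real m * real K * pgf (real m) (trunc_law m K mu K)"
    by (intro drift_le_pgf set_pmf_trunc_law) auto
  also have "\<dots> \<le> real m * real K * ?g"
    by (intro mult_left_mono G) auto
  finally show False
    using growth D[of K] by simp
qed

lemma (in rs) free_energy_ge_power:
  fixes e d :: real
  assumes "0 \<le> e" "e \<le> 1 / 2" "d > 0"
    and "drift (real m * (1 - e)) (trunc_pmf K mu) \<ge> d"
    and "real m * (real m * real K) * (1 - e) ^ K * (real m ^ 4 * (real K + 1)) ^ m \<le> e"
    and "real m * real K * (real m ^ 4 * (real K + 1)) < (1 + e) ^ K * d"
  shows "1 / real m ^ (2 * K) \<le> free_energy m mu"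
proof -
  from exists_mean_gt_2[OF assms] obtain n where n: "n \<le> 2 * K" "mean n > 2" by auto
  have "1 / real m ^ (2 * K) \<le> 1 / real m ^ n"
    using n m_ge_2 by (intro divide_left_mono power_increasing) auto
  also have "\<dots> \<le> (mean n - 1) / real m ^ n"
    using n by (intro divide_right_mono) auto
  also have "\<dots> \<le> free_energy m mu" by (rule free_energy_lower)
  finally show ?thesis .
qed

section \<open>Initial laws with the critical tail\<close>

lemma harm_le_ln_plus_1: "n \<ge> 1 \<Longrightarrow> harm n \<le> ln (real n) + (1 :: real)"
  using decseqD[OF decseq_harm_diff_ln, of 0 "n - 1"] by (cases n) (auto simp: harm_expand)

text \<open>Only finitely many b k exceed c, and their total excess fits into a constant independent
  of N.\<close>

lemma weighted_harmonic_le: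
  fixes b :: "nat \<Rightarrow> real"
  assumes "b \<longlonglongrightarrow> c0" "c0 < c"
  shows "\<exists>A\<ge>0. \<forall>N. (\<Sum>k=1..N. b k / real k) \<le> c * harm N + A"
proof -
  from order_tendstoD(2)[OF assms] obtain N0 where N0: "\<And>n. n \<ge> N0 \<Longrightarrow> b n \<le> c"
    unfolding eventually_sequentially using less_imp_le by blast
  define A where "A = (\<Sum>k=1..N0. \<bar>b k - c\<bar> / real k)"
  have "(\<Sum>k=1..N. b k / real k) \<le> c * harm N + A" for N
  proof -
    have "(\<Sum>k=1..N. b k / real k) - c * harm N = (\<Sum>k=1..N. (b k - c) / real k)"
      by (simp add: harm_def sum_distrib_left diff_divide_distrib sum_subtractf divide_inverse left_diff_distrib)
    also have "\<dots> \<le> (\<Sum>k=1..N. if k \<le> N0 then \<bar>b k - c\<bar> / real k else 0)"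
      using N0 by (intro sum_mono) (auto intro!: divide_right_mono divide_nonpos_nonneg)
    \<comment> \<open>The longer range makes the value independent of N, also when N < N0.\<close>
    also have "\<dots> \<le> (\<Sum>k=1..max N N0. if k \<le> N0 then \<bar>b k - c\<bar> / real k else 0)"
      by (intro sum_mono2) auto
    also have "\<dots> = A"
      unfolding A_def by (intro sum.mono_neutral_cong_right) auto
    finally show ?thesis by simp
  qed
  moreover have "A \<ge> 0"
    unfolding A_def by (intro sum_nonneg) auto
  ultimately show ?thesis by blast
qed

lemma weighted_harmonic_ge:
  fixes b :: "nat \<Rightarrow> real"
  assumes "b \<longlonglongrightarrow> c0" "c < c0"
  shows "\<exists>A\<ge>0. \<forall>N. c * harm N - A \<le> (\<Sum>k=1..N. b k / real k)"
proof -
  have "\<exists>A\<ge>0. \<forall>N. (\<Sum>k=1..N. - b k / real k) \<le> - c * harm N + A"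
    using assms by (intro weighted_harmonic_le[where ?c0.0 = "- c0"] tendsto_minus) auto
  then show ?thesis
    by (auto simp: sum_negf algebra_simps)
qed

section \<open>Truncated and mixed initial laws\<close>

lemma pmf_trunc_pmf: "0 < k \<Longrightarrow> k \<le> K \<Longrightarrow> pmf (trunc_pmf K mu) k = pmf mu k"
proof -
  assume "0 < k" "k \<le> K"
  then have "(\<lambda>x. if x \<le> K then x else 0) -` {k} = {k}"
    by (auto split: if_splits)
  then show ?thesis
    by (simp add: trunc_pmf_def pmf_map measure_pmf_single)
qed

lemma expectation_trunc_pmf:
  fixes f :: "nat \<Rightarrow> real"
  shows "measure_pmf.expectation (trunc_pmf K mu) f
       = f 0 * pmf (trunc_pmf K mu) 0 + (\<Sum>k=1..K. f k * pmf mu k)"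
proof -
  have "measure_pmf.expectation (trunc_pmf K mu) f = (\<Sum>k\<in>{..K}. f k * pmf (trunc_pmf K mu) k)"
    using set_pmf_trunc_pmf[of K mu] by (intro integral_measure_pmf_real) auto
  also have "{..K} = insert 0 {1..K}" by auto
  finally show ?thesis by (simp add: pmf_trunc_pmf)
qed

lemma trunc_pmf_mix_law:
  "trunc_pmf K (mix_law p X) = bind_pmf (bernoulli_pmf p) (\<lambda>b. if b then trunc_pmf K X else return_pmf 0)"
  unfolding trunc_pmf_def mix_law_def map_bind_pmf by (intro bind_pmf_cong) auto

text \<open>The drift is linear in the law, and a point mass at 0 has drift -1.\<close>

lemma drift_trunc_mix_law:
  assumes "0 \<le> p" "p \<le> 1"
  shows "drift s (trunc_pmf K (mix_law p X)) = p * drift s (trunc_pmf K X) - (1 - p)"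
  unfolding drift_def trunc_pmf_mix_law using assms
  by (subst expectation_bind_finite) (auto simp: integral_bernoulli_pmf)

lemma nn_integral_mix_law_le:
  assumes "0 \<le> p" "p \<le> 1" "f 0 = 0"
  shows "(\<integral>\<^sup>+x. f x \<partial>mix_law p X) \<le> (\<integral>\<^sup>+x. f x \<partial>X)"
proof -
  have "(\<integral>\<^sup>+x. f x \<partial>mix_law p X) = (\<integral>\<^sup>+x. f x \<partial>X) * ennreal p"
    using assms by (simp add: mix_law_def nn_integral_bernoulli_pmf)
  also have "\<dots> \<le> (\<integral>\<^sup>+x. f x \<partial>X) * 1"
    using assms by (intro mult_left_mono) auto
  finally show ?thesis by simp
qed

locale critical_tail =
  fixes m :: nat and X :: "nat pmf" and c0 :: real
  assumes m_ge_2: "m \<ge> 2" and c0_pos: "0 < c0"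
    and tail: "(\<lambda>k. pmf X k) \<sim>[at_top] (\<lambda>k. c0 / (real m ^ k * real k ^ 2))"
begin

text \<open>The normalised masses: b k / k = k m^k P(X = k) is the leading contribution of k to the
  drift at m, up to the factor m - 1. This is the source of the harmonic sums.\<close>

definition b :: "nat \<Rightarrow> real" where "b k = real k ^ 2 * real m ^ k * pmf X k"

lemma b_nonneg: "b k \<ge> 0"
  by (simp add: b_def)

lemma b_tendsto: "b \<longlonglongrightarrow> c0"
proof -
  have "((\<lambda>k. pmf X k / (c0 / (real m ^ k * real k ^ 2))) \<longlongrightarrow> 1) at_top"
  proof (rule asymp_equivD_strong[OF tail])
    show "\<forall>\<^sub>F k in sequentially. pmf X k \<noteq> 0 \<or> c0 / (real m ^ k * real k ^ 2) \<noteq> 0"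
      using eventually_gt_at_top[of 0] by eventually_elim (use m_ge_2 c0_pos in auto)
  qed
  then have "((\<lambda>k. c0 * (pmf X k / (c0 / (real m ^ k * real k ^ 2)))) \<longlongrightarrow> c0 * 1) at_top"
    by (intro tendsto_intros)
  then show ?thesis
    using c0_pos by (simp add: b_def[abs_def] mult_ac)
qed

lemma pmf_eq_b: "k > 0 \<Longrightarrow> pmf X k = b k / (real k ^ 2 * real m ^ k)"
  using m_ge_2 by (simp add: b_def)

lemma b_bounded: "\<exists>B>0. \<forall>k. b k \<le> B"
proof -
  have "Bseq b" using b_tendsto by (intro convergent_imp_Bseq convergentI)
  then obtain B where "B > 0" "\<And>k. norm (b k) \<le> B" by (auto elim: BseqE)
  then show ?thesis by (metis abs_le_D1 real_norm_def)
qed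

text \<open>Each term k P(X = k) is at most B m^(-k). The geometric sum from L + 1 on is at most
  m^(-L) because its ratio is at most 1/2.\<close>

lemma nn_integral_tail_le:
  assumes B: "B > 0" "\<And>k. b k \<le> B"
  shows "(\<integral>\<^sup>+x. ennreal (real x) * indicator {L<..} x \<partial>X) \<le> ennreal (B / real m ^ L)"
proof -
  define r where "r = 1 / real m"
  have r: "0 < r" "r \<le> 1 / 2" using m_ge_2 by (auto simp: r_def field_simps)
  define f where "f = (\<lambda>k. if k < Suc L then 0 else B * r ^ k)"
  have f_nonneg: "f k \<ge> 0" for k using B r by (simp add: f_def)
  have "(\<lambda>i. (B * r ^ Suc L) * r ^ i) sums ((B * r ^ Suc L) * (1 / (1 - r)))"
    using r by (intro sums_mult geometric_sums) auto
  then have "(\<lambda>i. f (i + Suc L)) sums ((B * r ^ Suc L) * (1 / (1 - r)))"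
    by (simp add: f_def power_add mult_ac)
  then have f_sums: "f sums ((B * r ^ Suc L) * (1 / (1 - r)))"
    by (subst (asm) sums_zero_iff_shift) (auto simp: f_def)
  have "(\<integral>\<^sup>+x. ennreal (real x) * indicator {L<..} x \<partial>X)
      = (\<Sum>k. ennreal (pmf X k) * (ennreal (real k) * indicator {L<..} k))"
    by (simp add: nn_integral_measure_pmf nn_integral_count_space_nat)
  also have "\<dots> \<le> (\<Sum>k. ennreal (f k))"
  proof (intro suminf_le allI)
    fix k
    show "ennreal (pmf X k) * (ennreal (real k) * indicator {L<..} k) \<le> ennreal (f k)"
    proof (cases "k > L")
      case True
      have "pmf X k * real k = b k / real k * r ^ k"
        using True by (simp add: pmf_eq_b power2_eq_square r_def power_divide)
      also have "\<dots> \<le> B / 1 * r ^ k"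
        using True B r b_nonneg by (intro mult_right_mono frac_le) auto
      also have "\<dots> = f k" using True by (simp add: f_def)
      finally show ?thesis
        using True by (simp add: ennreal_leI flip: ennreal_mult')
    qed simp
  qed auto
  also have "\<dots> = ennreal ((B * r ^ Suc L) * (1 / (1 - r)))"
    using f_sums f_nonneg by (simp add: suminf_ennreal2 sums_iff)
  also have "\<dots> \<le> ennreal (B / real m ^ L)"
  proof (intro ennreal_leI)
    have "r / (1 - r) \<le> 1" using r by simp
    then have "(B * r ^ L) * (r / (1 - r)) \<le> (B * r ^ L) * 1"
      using B r by (intro mult_left_mono) auto
    then show "(B * r ^ Suc L) * (1 / (1 - r)) \<le> B / real m ^ L"
      by (simp add: r_def power_divide mult_ac)
  qed
  finally show ?thesis .
qed

lemma pmf_mean_mix_law_finite: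
  assumes "0 \<le> p" "p \<le> 1"
  shows "pmf_mean (mix_law p X) < top"
proof -
  obtain B where B: "B > 0" "\<And>k. b k \<le> B" using b_bounded by blast
  have "pmf_mean (mix_law p X) \<le> pmf_mean X"
    unfolding pmf_mean_def by (rule nn_integral_mix_law_le) (use assms in auto)
  also have "\<dots> = (\<integral>\<^sup>+x. ennreal (real x) * indicator {0<..} x \<partial>X)"
    unfolding pmf_mean_def by (intro nn_integral_cong) (auto simp: indicator_def)
  also have "\<dots> < top"
    using nn_integral_tail_le[OF B, of 0] by (auto intro: le_less_trans)
  finally show ?thesis .
qed

lemma drift_trunc_le: "drift (real m) (trunc_pmf K X) \<le> (real m - 1) * (\<Sum>k=1..K. b k / real k)"
proof -
  have "drift (real m) (trunc_pmf K X) \<le> (\<Sum>k=1..K. ((real m - 1) * real k - 1) * real m ^ k * pmf X k)"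
    by (simp add: drift_def expectation_trunc_pmf)
  also have "\<dots> \<le> (\<Sum>k=1..K. (real m - 1) * (b k / real k))"
  proof (intro sum_mono)
    fix k assume "k \<in> {1..K}"
    then have "(real m - 1) * (b k / real k) = (real m - 1) * real k * real m ^ k * pmf X k"
      by (simp add: b_def power2_eq_square)
    then show "((real m - 1) * real k - 1) * real m ^ k * pmf X k \<le> (real m - 1) * (b k / real k)"
      by (simp add: left_diff_distrib)
  qed
  finally show ?thesis by (simp add: sum_distrib_left)
qed

text \<open>Up to M, Bernoulli's inequality gives (1 - e)^k >= 1 - e k >= 1 - d; the positive terms
  between M and K are dropped. The negative part is bounded uniformly in K, as its terms are at most
  B / k^2.\<close>

lemma drift_trunc_ge:
  assumes B: "B > 0" "\<And>k. b k \<le> B"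
    and e: "0 \<le> e" "e \<le> 1 / 2" and M: "M \<le> K" "e * real M \<le> d" "d \<le> 1"
  shows "(real m * (1 - e) - 1) * (1 - d) * (\<Sum>k=1..M. b k / real k) - (1 + B * (\<Sum>k. 1 / real k ^ 2))
      \<le> drift (real m * (1 - e)) (trunc_pmf K X)"
proof -
  define s where "s = real m * (1 - e)"
  have "2 * (1 / 2) \<le> s"
    unfolding s_def using m_ge_2 e by (intro mult_mono) auto
  then have s1: "s \<ge> 1" by simp
  have sm: "s \<le> real m"
    using e unfolding s_def by (simp add: mult_left_le)
  \<comment> \<open>The term at k = 0 is 1 / 0 = 0.\<close>
  have summ: "summable (\<lambda>k. 1 / real k ^ 2)"
    using inverse_power_summable[of 2, where 'a = real] by (simp add: divide_inverse)
  have first: "(s - 1) * (1 - d) * (\<Sum>k=1..M. b k / real k) \<le> (\<Sum>k=1..K. (s - 1) * real k * s ^ k * pmf X k)"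
  proof -
    have "(s - 1) * (1 - d) * (\<Sum>k=1..M. b k / real k) = (\<Sum>k=1..M. (s - 1) * (b k / real k) * (1 - d))"
      by (simp add: sum_distrib_left mult_ac)
    also have "\<dots> \<le> (\<Sum>k=1..M. (s - 1) * (b k / real k) * (1 - e) ^ k)"
    proof (intro sum_mono mult_left_mono)
      fix k assume k: "k \<in> {1..M}"
      have "real k * e \<le> d"
        using mult_left_mono[of "real k" "real M" e] k e M by (simp add: mult.commute)
      then have "1 - d \<le> 1 + real k * (- e)" by simp
      also have "\<dots> \<le> (1 + (- e)) ^ k"
        using e by (intro Bernoulli_inequality) auto
      finally show "1 - d \<le> (1 - e) ^ k" by simp
    qed (use s1 b_nonneg in auto)
    also have "\<dots> = (\<Sum>k=1..M. (s - 1) * real k * s ^ k * pmf X k)"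
      by (intro sum.cong) (auto simp: b_def s_def power_mult_distrib power2_eq_square)
    also have "\<dots> \<le> (\<Sum>k=1..K. (s - 1) * real k * s ^ k * pmf X k)"
      using M s1 by (intro sum_mono2) auto
    finally show ?thesis .
  qed
  have second: "(\<Sum>k=1..K. s ^ k * pmf X k) \<le> B * (\<Sum>k. 1 / real k ^ 2)"
  proof -
    have "(\<Sum>k=1..K. s ^ k * pmf X k) \<le> (\<Sum>k=1..K. B * (1 / real k ^ 2))"
    proof (intro sum_mono)
      fix k assume k: "k \<in> {1..K}"
      have "s ^ k * pmf X k \<le> real m ^ k * pmf X k"
        using s1 sm by (intro mult_right_mono power_mono) auto
      also have "\<dots> = b k * (1 / real k ^ 2)"
        using k by (simp add: b_def)
      also have "\<dots> \<le> B * (1 / real k ^ 2)"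
        by (intro mult_right_mono B) auto
      finally show "s ^ k * pmf X k \<le> B * (1 / real k ^ 2)" .
    qed
    also have "\<dots> = B * (\<Sum>k=1..K. 1 / real k ^ 2)"
      by (simp add: sum_distrib_left)
    also have "\<dots> \<le> B * (\<Sum>k. 1 / real k ^ 2)"
      using B summ by (intro mult_left_mono sum_le_suminf) auto
    finally show ?thesis .
  qed
  have "drift s (trunc_pmf K X)
      = - pmf (trunc_pmf K X) 0 + (\<Sum>k=1..K. (s - 1) * real k * s ^ k * pmf X k) - (\<Sum>k=1..K. s ^ k * pmf X k)"
    by (simp add: drift_def expectation_trunc_pmf left_diff_distrib sum_subtractf)
  then show ?thesis
    using first second pmf_le_1[of "trunc_pmf K X" 0] by (simp add: s_def)
qed

end

text \<open>The choice of e balances two demands: e tends to 0, yet e K = (ln K)^2, so that exp(- e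
  K) and exp(e K / 2) beat every power of K.\<close>

lemma eventually_growth_conditions:
  fixes m :: nat and d :: real
  assumes m: "m \<ge> 2" and d: "d > 0"
  shows "\<forall>\<^sub>F K in sequentially. let e = ln (real K) ^ 2 / real K in
    e \<le> 1 / 2 \<and>
    real m * (real m * real K) * (1 - e) ^ K * (real m ^ 4 * (real K + 1)) ^ m \<le> e \<and>
    real m * real K * (real m ^ 4 * (real K + 1)) < (1 + e) ^ K * d"
proof -
  \<comment> \<open>The loss estimate needs ln K >= 6m + 4 and the growth estimate ln K >= 18; 6m +
    16 serves both. The last condition lets powers of K absorb the factors m and 1 / d.\<close>
  have ev: "\<forall>\<^sub>F K in sequentially. ln (real K) ^ 2 / real K \<le> 1 / 2"
    "\<forall>\<^sub>F K in sequentially. real (6 * m + 16) \<le> ln (real K)"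
    "\<forall>\<^sub>F K in sequentially. real m + 2 + 1 / d < real K"
    by real_asymp+
  show ?thesis
    using ev
  proof eventually_elim
    case (elim K)
    define k where "k = real K"
    define e where "e = ln k ^ 2 / k"
    have "1 / d > 0" using d by simp
    then have k: "k \<ge> 2" "k > real m" "k > 1 / d"
      using elim(3) unfolding k_def by linarith+
    have lnk: "ln k \<ge> real (6 * m + 16)" "ln k \<ge> 1" using elim(2) by (auto simp: k_def)
    have e: "0 \<le> e" "e \<le> 1 / 2" using elim(1) k by (auto simp: e_def k_def)
    have ek: "e * k = ln k ^ 2" using k by (simp add: e_def)
    have kpow: "k ^ n = exp (real n * ln k)" for n
      using k by (simp add: exp_of_nat_mult)
    have g: "real m ^ 4 * (k + 1) \<le> k ^ 6"
    proof -
      have "real m ^ 4 * (k + 1) \<le> k ^ 4 * k ^ 2"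
      proof (intro mult_mono power_mono)
        have "2 * k \<le> k * k" using k by (intro mult_right_mono) auto
        then show "k + 1 \<le> k ^ 2" unfolding power2_eq_square using k by linarith
      qed (use k in auto)
      then show ?thesis by (simp flip: power_add)
    qed
    have "(1 - e) ^ K \<le> exp (- e) ^ K"
      using exp_ge_add_one_self[of "- e"] e by (intro power_mono) auto
    also have "\<dots> = exp (- (ln k ^ 2))"
      using ek by (simp add: k_def mult.commute flip: exp_of_nat_mult)
    finally have decay: "(1 - e) ^ K \<le> exp (- (ln k ^ 2))" .
    have "real m * (real m * k) * (1 - e) ^ K * (real m ^ 4 * (k + 1)) ^ m
        \<le> k * (k * k) * exp (- (ln k ^ 2)) * (k ^ 6) ^ m"
      using k e g decay by (intro mult_mono power_mono) auto
    \<comment> \<open>A factor 1 / k is split off to match e = (ln k)^2 / k; the rest only has to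
      stay below (ln k)^2.\<close>
    also have "\<dots> = k ^ (4 + 6 * m) * exp (- (ln k ^ 2)) / k"
    proof -
      have "k * (k * k) = k ^ 4 / k" using k by (simp add: eval_nat_numeral)
      then show ?thesis by (simp add: power_add power_mult)
    qed
    also have "k ^ (4 + 6 * m) * exp (- (ln k ^ 2)) = exp (ln k * (real (4 + 6 * m) - ln k))"
      unfolding kpow by (simp add: power2_eq_square algebra_simps flip: exp_add)
    also have "\<dots> \<le> exp 0"
      using lnk by (subst exp_le_cancel_iff, intro mult_nonneg_nonpos) auto
    also have "\<dots> \<le> ln k ^ 2"
      using lnk by simp
    finally have loss: "real m * (real m * k) * (1 - e) ^ K * (real m ^ 4 * (k + 1)) ^ m \<le> e"
      using k by (simp add: e_def divide_right_mono)
    have "real m * k * (real m ^ 4 * (k + 1)) \<le> k * k * k ^ 6"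
      using k g by (intro mult_mono) auto
    also have "\<dots> = k ^ 8 * 1"
      by (simp add: eval_nat_numeral)
    also have "\<dots> < k ^ 8 * (k * d)"
      using k d by (intro mult_strict_left_mono) (auto simp: field_simps)
    also have "\<dots> = k ^ 9 * d" by (simp add: eval_nat_numeral)
    also have "k ^ 9 \<le> exp (ln k ^ 2 / 2)"
    proof -
      have "ln k * 18 \<le> ln k * ln k"
        using lnk m by (intro mult_left_mono) auto
      then show ?thesis
        unfolding kpow by (simp add: power2_eq_square)
    qed
    also have "exp (ln k ^ 2 / 2) = exp (e / 2) ^ K"
      using ek by (simp add: k_def mult.commute flip: exp_of_nat_mult)
    also have "exp (e / 2) ^ K \<le> (1 + e) ^ K"
    proof (intro power_mono)
      have "exp (e / 2) \<le> 1 + e / 2 + (e / 2) ^ 2"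
        using e by (intro exp_bound) auto
      also have "(e / 2) ^ 2 \<le> e / 2"
        using e mult_left_mono[of "e / 2" 1 "e / 2"] by (simp add: power2_eq_square)
      finally show "exp (e / 2) \<le> 1 + e" by simp
    qed auto
    finally have "real m * k * (real m ^ 4 * (k + 1)) < (1 + e) ^ K * d"
      using d by simp
    with loss e show ?case
      by (simp add: Let_def e_def k_def)
  qed
qed

section \<open>Matching bounds on the free energy as p tends to 0\<close>

context critical_tail
begin

text \<open>Lowering s from m to m (1 - e) costs only a lower-order term: the harmonic sum up to a
  cutoff near K / (ln K)^3 already has the leading term ln K.\<close>

lemma eventually_drift_trunc_ge:
  assumes "c < c0" "c > 0"
  shows "\<forall>\<^sub>F K in sequentially. (real m - 1) * c * ln (real K)
      \<le> drift (real m * (1 - ln (real K) ^ 2 / real K)) (trunc_pmf K X)"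
proof -
  define c1 where "c1 = (c + c0) / 2"
  have c1: "c < c1" "c1 < c0" "c1 > 0" using assms by (auto simp: c1_def)
  obtain A where A: "A \<ge> 0" "\<And>N. c1 * harm N - A \<le> (\<Sum>k=1..N. b k / real k)"
    using weighted_harmonic_ge[OF b_tendsto c1(2)] by blast
  obtain B where B: "B > 0" "\<And>k. b k \<le> B" using b_bounded by blast
  define A' where "A' = 1 + B * (\<Sum>k. 1 / real k ^ 2)"
  define a where "a = real m - 1"
  have a: "a \<ge> 1" "real m = a + 1" using m_ge_2 by (auto simp: a_def)
  \<comment> \<open>This is the bound of \<open>drift_trunc_ge\<close> with d = 1 / ln K and the
    harmonic sum replaced by ln K - 3 ln (ln K), all divided by ln K.\<close>
  have "((\<lambda>K. (((a + 1) * (1 - ln (real K) ^ 2 / real K) - 1) * (1 - 1 / ln (real K))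
      * (c1 * (ln (real K) - 3 * ln (ln (real K))) - A) - A') / ln (real K)) \<longlongrightarrow> a * c1) sequentially"
    by real_asymp
  moreover have "a * c < a * c1" using c1 a by simp
  ultimately have "\<forall>\<^sub>F K in sequentially. a * c < (((a + 1) * (1 - ln (real K) ^ 2 / real K) - 1)
      * (1 - 1 / ln (real K)) * (c1 * (ln (real K) - 3 * ln (ln (real K))) - A) - A') / ln (real K)"
    by (rule order_tendstoD)
  moreover have "\<forall>\<^sub>F K in sequentially. ln (real K) ^ 2 / real K \<le> 1 / 2"
    "\<forall>\<^sub>F K in sequentially. 1 < ln (real K)"
    by real_asymp+
  ultimately show ?thesis
  proof eventually_elim
    case (elim K)
    define l where "l = ln (real K)"
    define e where "e = l ^ 2 / real K"
    \<comment> \<open>This cutoff has \<open>e * M \<rightarrow> 0\<close>, so \<open>(1 - e) ^ k\<close> is close to \<open>1\<close> for \<open>k \<le> M\<close>, and still \<open>ln M \<sim> ln K\<close>.\<close>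
    define M where "M = nat \<lfloor>real K / l ^ 3\<rfloor>"
    have l: "l > 1" using elim by (simp add: l_def)
    then have K: "real K > 0" by (cases K) (auto simp: l_def)
    have e: "0 \<le> e" "e \<le> 1 / 2" using elim K by (auto simp: e_def l_def)
    have M1: "real M \<le> real K / l ^ 3" using l K by (simp add: M_def)
    have M2: "real K / l ^ 3 \<le> real M + 1" unfolding M_def by linarith
    have "real K / l ^ 3 \<le> real K / 1"
      using l K by (intro divide_left_mono) auto
    then have MK: "M \<le> K" using M1 by simp
    have "e * real M \<le> e * (real K / l ^ 3)"
      using M1 e by (intro mult_left_mono) auto
    also have "\<dots> = 1 / l"
      using l K by (simp add: e_def eval_nat_numeral)
    finally have eM: "e * real M \<le> 1 / l" .
    have "l - 3 * ln l = ln (real K / l ^ 3)"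
      using l K by (simp add: ln_div ln_realpow l_def)
    also have "\<dots> \<le> ln (real M + 1)"
      using M2 l K by (subst ln_le_cancel_iff) auto
    also have "\<dots> \<le> harm M" by (rule ln_le_harm)
    finally have "c1 * (l - 3 * ln l) - A \<le> c1 * harm M - A"
      using c1 by simp
    also have "\<dots> \<le> (\<Sum>k=1..M. b k / real k)" by (rule A)
    finally have T: "c1 * (l - 3 * ln l) - A \<le> (\<Sum>k=1..M. b k / real k)" .
    have "2 * (1 / 2) \<le> real m * (1 - e)"
      using m_ge_2 e by (intro mult_mono) auto
    then have "a * c * l \<le> (real m * (1 - e) - 1) * (1 - 1 / l) * (c1 * (l - 3 * ln l) - A) - A'"
      using elim(1) l by (simp add: pos_less_divide_eq a(2) l_def e_def)
    also have "\<dots> \<le> (real m * (1 - e) - 1) * (1 - 1 / l) * (\<Sum>k=1..M. b k / real k) - A'"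
      using T l \<open>2 * (1 / 2) \<le> real m * (1 - e)\<close>
      by (intro diff_right_mono mult_left_mono mult_nonneg_nonneg) auto
    also have "\<dots> \<le> drift (real m * (1 - e)) (trunc_pmf K X)"
      unfolding A'_def using l by (intro drift_trunc_ge B e MK eM) auto
    finally show ?case by (simp add: a_def e_def l_def)
  qed
qed

lemma rs_mix_law: "0 \<le> p \<Longrightarrow> p \<le> 1 \<Longrightarrow> rs m (mix_law p X)"
  by (rule rs.intro) (auto simp: m_ge_2 pmf_mean_mix_law_finite)

definition C :: real where "C = 1 / ((real m - 1) * c0)"

lemma C_pos: "C > 0"
  using m_ge_2 c0_pos by (simp add: C_def)

lemma eventually_free_energy_ge:
  assumes "C < u'"
  shows "\<forall>\<^sub>F p in at_right 0. exp (- exp (u' / p)) \<le> free_energy_p m X p"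
proof -
  \<comment> \<open>Trisection gives C < v < u < u'. The drift estimate uses v > C, so K near exp(u
    / p) leaves the mixed law a drift of at least u / v - 1 > 0; the gap from u to u' absorbs the
    factor 2 ln m in m^(-2K).\<close>
  define u where "u = (C + 2 * u') / 3"
  define v where "v = (2 * C + u') / 3"
  have uv: "0 < v" "C < v" "v < u" "u < u'" "0 < u"
    using assms C_pos by (auto simp: u_def v_def)
  define c where "c = 1 / ((real m - 1) * v)"
  have c: "c > 0" using m_ge_2 uv by (simp add: c_def)
  have mc: "(real m - 1) * c = 1 / v" using m_ge_2 by (simp add: c_def)
  have "c < c0"
  proof -
    have "1 / ((real m - 1) * v) < 1 / ((real m - 1) * C)"
      using m_ge_2 uv C_pos by (intro divide_strict_left_mono) auto
    also have "\<dots> = c0" using m_ge_2 c0_pos by (simp add: C_def)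
    finally show ?thesis by (simp add: c_def)
  qed
  define d where "d = u / v - 1"
  have d: "d > 0" using uv by (simp add: d_def)
  define K where "K = (\<lambda>p. nat \<lceil>exp (u / p)\<rceil>)"
  have "filterlim (\<lambda>p. exp (u / p)) at_top (at_right 0)"
    using uv by real_asymp
  then have "filterlim K at_top (at_right 0)"
    unfolding filterlim_at_top
  proof (intro allI)
    fix Z :: nat
    assume "\<forall>Z. \<forall>\<^sub>F p in at_right 0. Z \<le> exp (u / p)"
    then have "\<forall>\<^sub>F p in at_right 0. real Z \<le> exp (u / p)" by blast
    then show "\<forall>\<^sub>F p in at_right 0. Z \<le> K p"
      by eventually_elim (unfold K_def, linarith)
  qed
  note ev = eventually_compose_filterlim[OF _ this]
  have "\<forall>\<^sub>F p in at_right 0. 2 * ln (real m) * (exp (u / p) + 1) \<le> exp (u' / p)"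
  proof -
    have "ln (real m) > 0" using m_ge_2 by simp
    moreover have "u' > 0" using uv by simp
    ultimately show ?thesis using uv by real_asymp
  qed
  moreover have "\<forall>\<^sub>F p in at_right (0 :: real). 0 < p \<and> p < 1"
    using eventually_at_right_real[of 0 1] by simp
  ultimately show ?thesis
    using ev[OF eventually_growth_conditions[OF m_ge_2 d]]
      ev[OF eventually_drift_trunc_ge[OF \<open>c < c0\<close> c]]
  proof eventually_elim
    case (elim p)
    define e where "e = ln (real (K p)) ^ 2 / real (K p)"
    have K1: "exp (u / p) \<le> real (K p)" unfolding K_def by linarith
    have K2: "real (K p) \<le> exp (u / p) + 1" unfolding K_def by (smt (verit) exp_gt_zero of_int_ceiling_le_add_one of_nat_nat zero_le_ceiling)
    have "ln (exp (u / p)) \<le> ln (real (K p))"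
      using K1 by (intro ln_mono) auto
    then have pK: "u \<le> p * ln (real (K p))"
      using elim(2) by (simp add: field_simps)
    interpret rs m "mix_law p X"
      using elim(2) by (intro rs_mix_law) auto
    have "d \<le> p * ln (real (K p)) / v - 1"
      using pK uv by (simp add: d_def divide_right_mono)
    also have "\<dots> = p * ((real m - 1) * c * ln (real (K p))) - 1"
      by (simp add: mc)
    also have "\<dots> \<le> p * drift (real m * (1 - e)) (trunc_pmf (K p) X) - (1 - p)"
    proof -
      have "p * ((real m - 1) * c * ln (real (K p))) \<le> p * drift (real m * (1 - e)) (trunc_pmf (K p) X)"
        unfolding e_def using elim(2,4) by (intro mult_left_mono) auto
      then show ?thesis using elim(2) by linarith
    qed
    also have "\<dots> = drift (real m * (1 - e)) (trunc_pmf (K p) (mix_law p X))"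
      using elim(2) by (simp add: drift_trunc_mix_law)
    finally have D: "d \<le> drift (real m * (1 - e)) (trunc_pmf (K p) (mix_law p X))" .
    have "2 * ln (real m) * real (K p) \<le> 2 * ln (real m) * (exp (u / p) + 1)"
      using K2 m_ge_2 by (intro mult_left_mono) auto
    then have "exp (- exp (u' / p)) \<le> exp (- (2 * ln (real m) * real (K p)))"
      using elim(1) by simp
    also have "\<dots> = 1 / exp (real (2 * K p) * ln (real m))"
      by (simp add: exp_minus divide_inverse mult_ac)
    also have "\<dots> = 1 / real m ^ (2 * K p)"
      using m_ge_2 by (subst exp_of_nat_mult) simp
    also have "\<dots> \<le> free_energy m (mix_law p X)"
      using elim(3) D d by (intro free_energy_ge_power[of e d]) (auto simp: e_def Let_def)
    finally show ?case by (simp add: free_energy_p_def)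
  qed
qed

lemma eventually_free_energy_le:
  assumes "0 < u'" "u' < C"
  shows "\<forall>\<^sub>F p in at_right 0. free_energy_p m X p \<le> exp (- exp (u' / p))"
proof -
  \<comment> \<open>Now u' < u < v < C. Truncating at exp(u / p) makes the drift at most u / v - 1 +
    O(p), which is eventually negative; the gap from u' to u absorbs B and ln m in B m^(-L).\<close>
  define u where "u = (C + 2 * u') / 3"
  define v where "v = (2 * C + u') / 3"
  have uv: "0 < v" "v < C" "u < v" "u' < u" "0 < u"
    using assms C_pos by (auto simp: u_def v_def)
  define c where "c = 1 / ((real m - 1) * v)"
  have c: "c > 0" using m_ge_2 uv by (simp add: c_def)
  have mc: "(real m - 1) * c = 1 / v" using m_ge_2 by (simp add: c_def)
  have "c0 < c"
  proof -
    have "c0 = 1 / ((real m - 1) * C)" using m_ge_2 c0_pos by (simp add: C_def)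
    also have "\<dots> < 1 / ((real m - 1) * v)"
      using m_ge_2 uv C_pos by (intro divide_strict_left_mono) auto
    finally show ?thesis by (simp add: c_def)
  qed
  obtain A where A: "A \<ge> 0" "\<And>N. (\<Sum>k=1..N. b k / real k) \<le> c * harm N + A"
    using weighted_harmonic_le[OF b_tendsto \<open>c0 < c\<close>] by blast
  obtain B where B: "B > 0" "\<And>k. b k \<le> B" using b_bounded by blast
  \<comment> \<open>Here c comes from harm L <= ln L + 1, A from the harmonic comparison, and the
    final 1 from the p in -(1 - p).\<close>
  define A' where "A' = (real m - 1) * (c + A) + 1"
  have "((\<lambda>p. u / v - 1 + p * A') \<longlongrightarrow> u / v - 1 + 0 * A') (at_right 0)"
    by (intro tendsto_intros)
  moreover have "u / v - 1 + 0 * A' < 0" using uv by simp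
  ultimately have "\<forall>\<^sub>F p in at_right 0. u / v - 1 + p * A' < 0"
    by (rule order_tendstoD)
  moreover have "\<forall>\<^sub>F p in at_right 0. ln B + exp (u' / p) \<le> (exp (u / p) - 1) * ln (real m)"
  proof -
    have "ln (real m) > 0" using m_ge_2 by simp
    then show ?thesis using uv assms by real_asymp
  qed
  moreover have "\<forall>\<^sub>F p in at_right (0 :: real). 0 < p \<and> p < 1"
    using eventually_at_right_real[of 0 1] by simp
  ultimately show ?thesis
  proof eventually_elim
    case (elim p)
    define L where "L = nat \<lfloor>exp (u / p)\<rfloor>"
    have "u / p > 0" using uv elim by simp
    then have L1: "L \<ge> 1" unfolding L_def by (simp add: le_nat_iff)
    have L2: "real L \<le> exp (u / p)" unfolding L_def by simp
    have L3: "exp (u / p) - 1 \<le> real L" unfolding L_def by linarith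
    have "ln (real L) \<le> ln (exp (u / p))"
      using L1 L2 by (intro ln_mono) auto
    then have lnL: "ln (real L) \<le> u / p" by simp
    note drift_trunc_le[of L]
    also have "(real m - 1) * (\<Sum>k=1..L. b k / real k) \<le> (real m - 1) * (c * harm L + A)"
      using A(2)[of L] m_ge_2 by (intro mult_left_mono) auto
    also have "\<dots> \<le> (real m - 1) * (c * (u / p + 1) + A)"
      using harm_le_ln_plus_1[OF L1] lnL c m_ge_2 by (intro mult_left_mono add_right_mono) auto
    finally have "p * drift (real m) (trunc_pmf L X) \<le> p * ((real m - 1) * (c * (u / p + 1) + A))"
      using elim by (intro mult_left_mono) auto
    also have "\<dots> = ((real m - 1) * c) * u + p * ((real m - 1) * (c + A))"
      using elim by (simp add: field_simps)
    also have "\<dots> = u / v + p * A' - p"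
      unfolding mc A'_def by (simp add: distrib_left)
    finally have "drift (real m) (trunc_pmf L (mix_law p X)) \<le> u / v - 1 + p * A'"
      using elim by (simp add: drift_trunc_mix_law)
    then have D: "drift (real m) (trunc_pmf L (mix_law p X)) \<le> 0"
      using elim by linarith
    have "(\<integral>\<^sup>+x. ennreal (real x) * indicator {L<..} x \<partial>mix_law p X)
        \<le> (\<integral>\<^sup>+x. ennreal (real x) * indicator {L<..} x \<partial>X)"
      using elim by (intro nn_integral_mix_law_le) auto
    also have "\<dots> \<le> ennreal (B / real m ^ L)"
      by (rule nn_integral_tail_le[OF B])
    finally have "free_energy m (mix_law p X) \<le> B / real m ^ L"
      using elim B m_ge_2 D by (intro free_energy_le_tail_mean pmf_mean_mix_law_finite) auto
    also have "\<dots> = exp (ln B - real L * ln (real m))"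
      using B m_ge_2 by (simp add: exp_diff exp_of_nat_mult)
    also have "\<dots> \<le> exp (- exp (u' / p))"
    proof -
      have "(exp (u / p) - 1) * ln (real m) \<le> real L * ln (real m)"
        using L3 m_ge_2 by (intro mult_right_mono) auto
      then show ?thesis using elim by simp
    qed
    finally show ?case by (simp add: free_energy_p_def)
  qed
qed

text \<open>The bounds with exponents C - e and C + e are inverted by taking two logarithms; a free
  energy strictly between 0 and 1 makes the outer one an honest logarithm of a positive
  number.\<close>

lemma eventually_free_energy_bounds:
  assumes "0 < e" "e < C"
  shows "\<forall>\<^sub>F p in at_right 0. 0 < p \<and> 0 < free_energy_p m X p \<and> free_energy_p m X p < 1 \<and>
    \<bar>p * ln (- ln (free_energy_p m X p)) - C\<bar> \<le> e"
proof -
  have "C < C + e" "0 < C - e" "C - e < C" using assms by auto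
  note bounds = eventually_free_energy_ge[OF this(1)] eventually_free_energy_le[OF this(2,3)]
  show ?thesis
    using eventually_at_right_less[of "0 :: real"] bounds
  proof eventually_elim
    case (elim p)
    let ?F = "free_energy_p m X p"
    have F0: "0 < ?F" using elim(2) exp_gt_zero by (meson less_le_trans)
    note elim(3)
    also have "exp (- exp ((C - e) / p)) < 1" by simp
    finally have F1: "?F < 1" .
    have "ln ?F \<le> - exp ((C - e) / p)"
      using F0 elim(3) by (metis ln_exp ln_mono)
    then have "exp ((C - e) / p) \<le> - ln ?F" by simp
    then have "(C - e) / p \<le> ln (- ln ?F)"
      by (metis exp_gt_zero ln_exp ln_mono)
    then have 1: "C - e \<le> p * ln (- ln ?F)" using elim(1) by (simp add: field_simps)
    have "- exp ((C + e) / p) \<le> ln ?F"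
      using elim(2) by (metis exp_gt_zero ln_exp ln_mono)
    then have "- ln ?F \<le> exp ((C + e) / p)" by simp
    then have "ln (- ln ?F) \<le> (C + e) / p"
      using F0 F1 by (metis ln_exp ln_less_zero ln_mono neg_0_less_iff_less)
    then have 2: "p * ln (- ln ?F) \<le> C + e" using elim(1) by (simp add: field_simps)
    show ?case using elim(1) F0 F1 1 2 by auto
  qed
qed

text \<open>The lower bound makes the free energy positive for all small p > 0, so the set defining
  \<open>p_crit\<close> has elements arbitrarily close to 0.\<close>

lemma p_crit_eq_0: "p_crit m X = 0"
proof -
  let ?S = "{p \<in> {0..1}. 0 < free_energy_p m X p}"
  have ev: "\<forall>\<^sub>F p in at_right 0. 0 < free_energy_p m X p"
    using eventually_free_energy_bounds[of "C / 2"] C_pos by (auto elim!: eventually_mono)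
  have ex: "\<exists>p\<in>?S. p < y" if "y > 0" for y
  proof -
    have "\<forall>\<^sub>F p in at_right (0 :: real). p \<in> {0<..<min 1 y}"
      using that by (intro eventually_at_right_real) auto
    with ev have "\<forall>\<^sub>F p in at_right 0. p \<in> ?S \<and> p < y"
      by eventually_elim auto
    then show ?thesis
      using eventually_happens[of _ "at_right (0 :: real)"] by fastforce
  qed
  show ?thesis
    unfolding p_crit_def
  proof (rule cInf_eq_non_empty)
    show "?S \<noteq> {}" using ex[of 1] by auto
  next
    fix y assume y: "\<And>x. x \<in> ?S \<Longrightarrow> y \<le> x"
    show "y \<le> 0"
    proof (rule ccontr)
      assume "\<not> y \<le> 0"
      then show False using ex[of y] y by force
    qed
  qed auto
qed

lemma free_energy_asymptotics:
  "\<exists>\<epsilon> :: real \<Rightarrow> real. (\<epsilon> \<longlongrightarrow> 0) (at_right 0) \<and>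
     (\<forall>\<^sub>F p in at_right 0. free_energy_p m X p = exp (- exp ((C + \<epsilon> p) / p)))"
proof (intro exI conjI)
  \<comment> \<open>The error term is found by solving the claimed identity for it, which is
    legitimate once the free energy lies strictly between 0 and 1.\<close>
  let ?eps = "\<lambda>p. p * ln (- ln (free_energy_p m X p)) - C"
  show "(?eps \<longlongrightarrow> 0) (at_right 0)"
  proof (rule tendstoI)
    fix e :: real assume "e > 0"
    then have "0 < min (e / 2) (C / 2)" "min (e / 2) (C / 2) < C" using C_pos by auto
    from eventually_free_energy_bounds[OF this]
    show "\<forall>\<^sub>F p in at_right 0. dist (?eps p) 0 < e"
      using \<open>e > 0\<close> by (auto elim!: eventually_mono)
  qed
  have "\<forall>\<^sub>F p in at_right 0. 0 < p \<and> 0 < free_energy_p m X p \<and> free_energy_p m X p < 1 \<and>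
      \<bar>?eps p\<bar> \<le> C / 2"
    using C_pos by (intro eventually_free_energy_bounds) auto
  then show "\<forall>\<^sub>F p in at_right 0. free_energy_p m X p = exp (- exp ((C + ?eps p) / p))"
    by eventually_elim simp
qed

end

theorem theorem1p3:
  fixes m :: nat and X :: "nat pmf" and c0 :: real
  assumes "m \<ge> 2"
    and "set_pmf X \<subseteq> {1..}"
    and "0 < c0"
    and "(\<lambda>k. pmf X k) \<sim>[at_top] (\<lambda>k. c0 / (real m ^ k * real k ^ 2))"
  shows "p_crit m X = 0
    \<and> (\<exists>\<epsilon> :: real \<Rightarrow> real. (\<epsilon> \<longlongrightarrow> 0) (at_right 0) \<and>
         (\<forall>\<^sub>F p in at_right 0.
            free_energy_p m X p = exp (- exp ((1 / ((real m - 1) * c0) + \<epsilon> p) / p))))"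
  proof -
  interpret critical_tail m X c0
    by (rule critical_tail.intro) (use assms in auto)
  show ?thesis
    using p_crit_eq_0 free_energy_asymptotics by (simp add: C_def)
qed

end
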